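(* Let $D$ be a connected locally-finite digraph with more than one end, and suppose that $D$ embeds a triangle. Then $D$ is connected-homogeneous if and only if it is isomorphic to $T(r)$ for some $r\in\mathbb{N}$.
   Context: A digraph is a set with an irreflexive antisymmetric arc relation $\to$; connectivity and ends refer to the underlying undirected graph (ends of a connected locally-finite graph are equivalence classes of rays, two rays being equivalent if some third ray meets each infinitely often). "Embeds a triangle" means the underlying undirected graph has three mutually adjacent vertices. Locally-finite: finite in- and out-degrees. Connected-homogeneous: every isomorphism between finite connected induced subdigraphs extends to an automorphism. $T(r)$ is the directed Cayley graph of the free product $\langle a_1\rangle*\cdots*\langle a_r\rangle$ with $a_i^3=1$, with respect to the generating set $\{a_1,\dots,a_r\}$, i.e. vertices are group elements and arcs are $g\to ga_i$. *)

theory Defs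
  imports Main
begin

definition digraph :: "'a set \<Rightarrow> ('a \<Rightarrow> 'a \<Rightarrow> bool) \<Rightarrow> bool" where
  "digraph V A \<longleftrightarrow> (\<forall>x y. A x y \<longrightarrow> x \<in> V \<and> y \<in> V) \<and>
     (\<forall>x. \<not> A x x) \<and> (\<forall>x y. A x y \<longrightarrow> \<not> A y x)"

definition uadj :: "('a \<Rightarrow> 'a \<Rightarrow> bool) \<Rightarrow> 'a \<Rightarrow> 'a \<Rightarrow> bool" where
  "uadj A x y \<longleftrightarrow> A x y \<or> A y x"

definition uconnected_on :: "'a set \<Rightarrow> ('a \<Rightarrow> 'a \<Rightarrow> bool) \<Rightarrow> bool" where
  "uconnected_on X A \<longleftrightarrow>
     (\<forall>x\<in>X. \<forall>y\<in>X. (\<lambda>u v. u \<in> X \<and> v \<in> X \<and> uadj A u v)\<^sup>*\<^sup>* x y)"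

definition connected_digraph :: "'a set \<Rightarrow> ('a \<Rightarrow> 'a \<Rightarrow> bool) \<Rightarrow> bool" where
  "connected_digraph V A \<longleftrightarrow> V \<noteq> {} \<and> uconnected_on V A"

definition locally_finite :: "'a set \<Rightarrow> ('a \<Rightarrow> 'a \<Rightarrow> bool) \<Rightarrow> bool" where
  "locally_finite V A \<longleftrightarrow> (\<forall>x\<in>V. finite {y. A x y} \<and> finite {y. A y x})"

definition is_ray :: "'a set \<Rightarrow> ('a \<Rightarrow> 'a \<Rightarrow> bool) \<Rightarrow> (nat \<Rightarrow> 'a) \<Rightarrow> bool" where
  "is_ray V A f \<longleftrightarrow> inj f \<and> range f \<subseteq> V \<and> (\<forall>n. uadj A (f n) (f (Suc n)))"

definition ray_equiv :: "'a set \<Rightarrow> ('a \<Rightarrow> 'a \<Rightarrow> bool) \<Rightarrow> (nat \<Rightarrow> 'a) \<Rightarrow> (nat \<Rightarrow> 'a) \<Rightarrow> bool" where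
  "ray_equiv V A f g \<longleftrightarrow> (\<exists>h. is_ray V A h \<and>
      infinite (range h \<inter> range f) \<and> infinite (range h \<inter> range g))"

definition more_than_one_end :: "'a set \<Rightarrow> ('a \<Rightarrow> 'a \<Rightarrow> bool) \<Rightarrow> bool" where
  "more_than_one_end V A \<longleftrightarrow>
     (\<exists>f g. is_ray V A f \<and> is_ray V A g \<and> \<not> ray_equiv V A f g)"

definition embeds_triangle :: "'a set \<Rightarrow> ('a \<Rightarrow> 'a \<Rightarrow> bool) \<Rightarrow> bool" where
  "embeds_triangle V A \<longleftrightarrow> (\<exists>x\<in>V. \<exists>y\<in>V. \<exists>z\<in>V. x \<noteq> y \<and> y \<noteq> z \<and> x \<noteq> z \<and>
      uadj A x y \<and> uadj A y z \<and> uadj A x z)"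

definition automorphism :: "'a set \<Rightarrow> ('a \<Rightarrow> 'a \<Rightarrow> bool) \<Rightarrow> ('a \<Rightarrow> 'a) \<Rightarrow> bool" where
  "automorphism V A g \<longleftrightarrow> bij_betw g V V \<and> (\<forall>x\<in>V. \<forall>y\<in>V. A x y \<longleftrightarrow> A (g x) (g y))"

definition connected_homogeneous :: "'a set \<Rightarrow> ('a \<Rightarrow> 'a \<Rightarrow> bool) \<Rightarrow> bool" where
  "connected_homogeneous V A \<longleftrightarrow>
     (\<forall>X Y f. X \<subseteq> V \<and> Y \<subseteq> V \<and> finite X \<and> finite Y \<and>
        uconnected_on X A \<and> uconnected_on Y A \<and>
        bij_betw f X Y \<and> (\<forall>x\<in>X. \<forall>y\<in>X. A x y \<longleftrightarrow> A (f x) (f y)) \<longrightarrow>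
        (\<exists>g. automorphism V A g \<and> (\<forall>x\<in>X. g x = f x)))"

definition digraph_iso ::
  "'a set \<Rightarrow> ('a \<Rightarrow> 'a \<Rightarrow> bool) \<Rightarrow> 'b set \<Rightarrow> ('b \<Rightarrow> 'b \<Rightarrow> bool) \<Rightarrow> bool" where
  "digraph_iso V A W B \<longleftrightarrow>
     (\<exists>f. bij_betw f V W \<and> (\<forall>x\<in>V. \<forall>y\<in>V. A x y \<longleftrightarrow> B (f x) (f y)))"

text \<open>T(r): elements of the free product of r copies of Z/3 (generators a_0..a_(r-1))
  as reduced words: lists of (generator index i < r, exponent e in {1,2}) with
  consecutive letters having distinct indices.  Arcs g -> g a_i.\<close>

definition T_V :: "nat \<Rightarrow> (nat \<times> nat) list set" where
  "T_V r = {w. (\<forall>p\<in>set w. fst p < r \<and> snd p \<in> {1,2}) \<and>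
                (\<forall>k. Suc k < length w \<longrightarrow> fst (w ! k) \<noteq> fst (w ! Suc k))}"

definition mult_gen :: "(nat \<times> nat) list \<Rightarrow> nat \<Rightarrow> (nat \<times> nat) list" where
  "mult_gen w i =
     (if w \<noteq> [] \<and> fst (last w) = i
      then (if snd (last w) = 1 then butlast w @ [(i, 2)] else butlast w)
      else w @ [(i, 1)])"

definition T_arc :: "nat \<Rightarrow> (nat \<times> nat) list \<Rightarrow> (nat \<times> nat) list \<Rightarrow> bool" where
  "T_arc r w v \<longleftrightarrow> w \<in> T_V r \<and> (\<exists>i<r. v = mult_gen w i)"

end

theory Submission
  imports Defs
begin

text \<open>
  Both directions go through \<^emph>\<open>triangle trees\<close>: connected digraphs in which every arc lies in exactly one
  triangle, this triangle is directed, all out-degrees are \<open>r\<close>, and two neighbours of a vertex \<open>x\<close> that are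
  joined by a path avoiding \<open>x\<close> are equal or adjacent. Such digraphs allow every isomorphism between
  connected induced subdigraphs to be extended vertex by vertex, so any two with the same \<open>r\<close> are
  isomorphic and each is connected-homogeneous; \<open>T(r)\<close> is one of them.

  Conversely, let \<open>D\<close> be connected-homogeneous. Among the edge cuts of minimal size with two infinite sides,
  those crossing the fewest others form a nested system invariant under automorphisms (Dunwoody). Its
  structure tree is used through equivariant maps from \<open>D\<close> to its vertices. All arcs have the same length in
  the tree, so triangles are mapped to tripods. By homogeneity, either the tree paths from
  \<open>x\<close> to its neighbours all start with the same edge, and then all vertices can be moved across these edges,
  shortening the arcs; or two of these paths start with the same edge exactly if the neighbours are equal or
  adjacent. In the second case walks without shortcuts follow geodesics of the tree, which gives the
  separation property, and cliques are homogeneous tournaments, which have only three vertices by a parity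
  argument.
\<close>

section \<open>From ends to finite cuts\<close>

text \<open>Homogeneity controls only vertices with their neighbours, whereas the separation
  property is global; the structure tree mediates between the two. Homogeneity puts the images of
  adjacent vertices at one common distance \<open>n\<close>. In a tree, three points at mutual
  distance \<open>n\<close> have a median at distance \<open>n/2\<close> from each, so the tree
  paths from a vertex to two adjacent neighbours share their first edge. The converse, that
  neighbours with a common first edge are equal or adjacent, may fail for the obvious map given by
  membership in cuts. The map is therefore not fixed in advance: each failure yields a map with
  smaller \<open>n\<close>, and \<open>n = 0\<close> is excluded because the map cannot be constant
  along edges. Tree vertices are represented by choices of one side of each cut, and distances by
  cardinalities of differences of such choices. The parity argument compares two numbers attached to
  an arc: the directed triangles on it, and the transitive ones in which it joins source to sink.
  Counting out-neighbours in two ways shows that the first number exceeds the second by one, while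
  each is odd unless it is zero.\<close>

lemma infinite_range_inj: "inj (f :: nat \<Rightarrow> 'a) \<Longrightarrow> infinite (range f)"
  using finite_imageD infinite_UNIV_nat by blast

lemma uadj_sym: "uadj A x y \<longleftrightarrow> uadj A y x"
  by (auto simp: uadj_def)

section \<open>Paths between sets and the weaving of a third ray\<close>

lemma rtranclp_imp_successively:
  assumes "R\<^sup>*\<^sup>* x y"
  shows "\<exists>p. p \<noteq> [] \<and> hd p = x \<and> last p = y \<and> successively R p"
  using assms
proof (induction rule: rtranclp_induct)
  case base
  then show ?case by (intro exI[of _ "[x]"]) simp
next
  case (step y z)
  then obtain p where "p \<noteq> []" "hd p = x" "last p = y" "successively R p" by blast
  with step.hyps(2) show ?case
    by (intro exI[of _ "p @ [z]"]) (auto simp: successively_append_iff)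
qed

text \<open>A walk of minimal length from \<open>F\<close> to \<open>G\<close> works: a later visit
  to \<open>F\<close>, an earlier one to \<open>G\<close> or a repeated vertex would allow a piece
  to be cut off.\<close>

lemma shortest_path_between_sets:
  assumes "successively R p" "p \<noteq> []" "hd p \<in> F" "last p \<in> G" "set p \<subseteq> X"
  obtains q where "successively R q" "q \<noteq> []" "hd q \<in> F" "last q \<in> G" "set q \<subseteq> X"
    "distinct q" "set q \<inter> F = {hd q}" "set q \<inter> G = {last q}"
proof -
  let ?P = "\<lambda>q. successively R q \<and> q \<noteq> [] \<and> hd q \<in> F \<and> last q \<in> G \<and> set q \<subseteq> X"
  obtain q where q: "?P q" and min: "\<And>q'. ?P q' \<Longrightarrow> length q \<le> length q'"
    using ex_has_least_nat[of ?P p length] assms by blast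
  have F: "ys = []" if "q = ys @ y # zs" "y \<in> F" for ys y zs
  proof -
    have "?P (y # zs)" using q that by (auto simp: successively_append_iff)
    from min[OF this] that show ?thesis by simp
  qed
  have G: "zs = []" if "q = ys @ y # zs" "y \<in> G" for ys y zs
  proof -
    have "hd (ys @ [y]) = hd q" using that by (cases ys) auto
    then have "?P (ys @ [y])" using q that by (auto simp: successively_append_iff)
    from min[OF this] that show ?thesis by simp
  qed
  have "distinct q"
  proof (rule ccontr)
    assume "\<not> distinct q"
    then obtain xs ys zs y where e: "q = xs @ [y] @ ys @ [y] @ zs"
      using not_distinct_decomp by blast
    have "hd (xs @ [y] @ zs) = hd q" "last (xs @ [y] @ zs) = last q" unfolding e by (cases xs) auto
    then have "?P (xs @ [y] @ zs)" using q unfolding e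
      by (auto simp: successively_append_iff successively_Cons)
    from min[OF this] e show False by simp
  qed
  moreover have "set q \<inter> F = {hd q}"
  proof -
    have "y = hd q" if "y \<in> set q" "y \<in> F" for y
      using that F by (metis split_list append_Nil list.sel(1))
    then show ?thesis using q by auto
  qed
  moreover have "set q \<inter> G = {last q}"
  proof -
    have "y = last q" if "y \<in> set q" "y \<in> G" for y
      using that G by (metis split_list last_snoc)
    then show ?thesis using q by auto
  qed
  ultimately show ?thesis using that q by blast
qed

text \<open>Invariant for weaving a third ray between \<open>f\<close> and \<open>g\<close>: the
  finite path \<open>p\<close> ends on \<open>f\<close>, and the rest of \<open>f\<close> after that
  point, as well as some tail of \<open>g\<close>, is still free. Each extension exchanges the roles
  of \<open>f\<close> and \<open>g\<close>.\<close>

definition ray_head :: "('a \<Rightarrow> 'a \<Rightarrow> bool) \<Rightarrow> 'a set \<Rightarrow> (nat \<Rightarrow> 'a) \<Rightarrow> (nat \<Rightarrow> 'a) \<Rightarrow> 'a list \<Rightarrow> bool" where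
  "ray_head R V f g p \<longleftrightarrow> p \<noteq> [] \<and> distinct p \<and> set p \<subseteq> V \<and> successively R p \<and>
     (\<exists>a b. last p = f a \<and> set p \<inter> f ` {a<..} = {} \<and> set p \<inter> g ` {b..} = {})"

lemma ray_head_extend:
  assumes f: "is_ray V A f" and g: "is_ray V A g" and fg: "range f \<inter> range g = {}"
    and linked: "\<And>S. finite S \<Longrightarrow>
      \<exists>m n. f m \<notin> S \<and> (\<lambda>u v. u \<in> V - S \<and> v \<in> V - S \<and> uadj A u v)\<^sup>*\<^sup>* (f m) (g n)"
    and p: "ray_head (uadj A) V f g p"
  shows "\<exists>q. q \<noteq> [] \<and> ray_head (uadj A) V g f (p @ q)"
proof -
  obtain a b where ab: "last p = f a" "set p \<inter> f ` {a<..} = {}" "set p \<inter> g ` {b..} = {}"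
    and p': "p \<noteq> []" "distinct p" "set p \<subseteq> V" "successively (uadj A) p"
    using p unfolding ray_head_def by blast
  \<comment> \<open>Deleting initial segments of both rays along with \<open>p\<close> forces the
    link to leave \<open>f\<close> after \<open>f a\<close> and to reach \<open>g\<close> within its
    free tail.\<close>
  define S where "S = set p \<union> f ` {..a} \<union> g ` {..b}"
  have "finite S" by (simp add: S_def)
  let ?R = "\<lambda>u v. u \<in> V - S \<and> v \<in> V - S \<and> uadj A u v"
  obtain m n where mn: "f m \<notin> S" "?R\<^sup>*\<^sup>* (f m) (g n)"
    using linked[OF \<open>finite S\<close>] by blast
  then obtain q0 where q0: "q0 \<noteq> []" "hd q0 = f m" "last q0 = g n" "successively ?R q0"
    using rtranclp_imp_successively[OF mn(2)] by blast
  have injf: "inj f" and rf: "range f \<subseteq> V" and injg: "inj g" and rg: "range g \<subseteq> V"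
    using f g by (auto simp: is_ray_def)
  have sub: "set r \<subseteq> V - S" if "successively ?R r" "r \<noteq> []" "hd r \<in> V - S" for r
    using that by (induction r rule: induct_list012) auto
  have "set q0 \<subseteq> V - S"
    using sub[OF q0(4,1)] q0(2) mn(1) rf by auto
  moreover have "successively (uadj A) q0"
    using q0(4) by (rule successively_mono) auto
  moreover have "hd q0 \<in> range f" "last q0 \<in> range g" using q0 by auto
  ultimately obtain q where q: "successively (uadj A) q" "q \<noteq> []" "hd q \<in> range f" "last q \<in> range g"
    "set q \<subseteq> V - S" "distinct q" "set q \<inter> range f = {hd q}" "set q \<inter> range g = {last q}"
    using q0(1) by (elim shortest_path_between_sets[of "uadj A" q0 "range f" "range g" "V - S"])
  obtain m' n' where m': "hd q = f m'" and n': "last q = g n'" using q by blast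
  have "f m' \<notin> S" "g n' \<notin> S" using q(2,5) m' n' hd_in_set[OF q(2)] last_in_set[OF q(2)] by auto
  then have m'a: "m' > a" and n'b: "n' > b" by (auto simp: S_def not_le[symmetric])
  \<comment> \<open>The segment of \<open>f\<close> strictly between the end of \<open>p\<close> and
    the start of \<open>q\<close>; it is empty when \<open>m' = Suc a\<close>.\<close>
  define s where "s = map f [Suc a..<m']"
  have s1: "distinct s" unfolding s_def using injf by (auto simp: distinct_map intro: inj_on_subset)
  have s2: "successively (uadj A) (map f [i..<j])" for i j
  proof (induction j)
    case (Suc j)
    then show ?case
      using f by (cases j) (auto simp: is_ray_def successively_append_iff last_map)
  qed simp
  have s3: "set s = f ` {a<..<m'}" unfolding s_def by auto
  have s4: "set s \<inter> set p = {}" using ab s3 by auto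
  have s5: "set s \<inter> set q = {}"
  proof -
    have "f i \<notin> set q" if "i < m'" for i
      using q(7) m' that injf by (metis Int_iff inj_eq less_irrefl rangeI singletonD)
    then show ?thesis using s3 by auto
  qed
  have q4: "set p \<inter> set q = {}" using q(5) by (auto simp: S_def)
  have adj: "\<And>i. uadj A (f i) (f (Suc i))" using f by (auto simp: is_ray_def)
  have sq: "successively (uadj A) (p @ s @ q)"
  proof (cases "m' = Suc a")
    case True
    then show ?thesis using p' q adj ab m' by (auto simp: s_def successively_append_iff)
  next
    case False
    then have "Suc a < m'" using m'a by simp
    then obtain k where k: "m' = Suc k" "Suc a \<le> k" by (cases m') auto
    have "s \<noteq> []" "hd s = f (Suc a)" "last s = f k"
      using k by (auto simp: s_def hd_map simp del: upt_Suc) (simp add: last_map)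
    moreover have "successively (uadj A) s" unfolding s_def by (rule s2)
    ultimately show ?thesis using p' q adj ab m' k by (auto simp: successively_append_iff)
  qed
  have "ray_head (uadj A) V g f (p @ s @ q)"
    unfolding ray_head_def
  proof (intro conjI exI[of "\<lambda>a. \<exists>b. _ a b" n'] exI[of "\<lambda>b. _ \<and> _ \<and> _ b" "Suc m'"])
    show "p @ s @ q \<noteq> []" using p' by simp
    show "distinct (p @ s @ q)" using p' s1 q s4 s5 q4 by auto
    show "set (p @ s @ q) \<subseteq> V" using p' q s3 rf by auto
    show "successively (uadj A) (p @ s @ q)" by (rule sq)
    show "last (p @ s @ q) = g n'" using q n' by simp
    have "set q \<inter> g ` {n'<..} = {}"
    proof -
      have "g i \<notin> set q" if "i > n'" for i
        using q(8) n' that injg by (metis Int_iff inj_eq less_irrefl rangeI singletonD)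
      then show ?thesis by auto
    qed
    moreover have "set p \<inter> g ` {n'<..} = {}" using ab(3) n'b by auto
    moreover have "set s \<inter> g ` {n'<..} = {}" using fg s3 by auto
    ultimately show "set (p @ s @ q) \<inter> g ` {n'<..} = {}" by auto
    have "set q \<inter> f ` {Suc m'..} = {}"
    proof -
      have "f i \<notin> set q" if "i > m'" for i
        using q(7) m' that injf by (metis Int_iff inj_eq less_irrefl rangeI singletonD)
      then show ?thesis by auto
    qed
    moreover have "set p \<inter> f ` {Suc m'..} = {}" using ab(2) m'a by auto
    moreover have "set s \<inter> f ` {Suc m'..} = {}" using s3 injf by (auto simp: inj_eq)
    ultimately show "set (p @ s @ q) \<inter> f ` {Suc m'..} = {}" by auto
  qed
  then show ?thesis using q by (intro exI[of _ "s @ q"]) auto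
qed

lemma ray_from_growing_paths:
  fixes L :: "nat \<Rightarrow> 'a list"
  assumes L: "\<And>n. distinct (L n) \<and> set (L n) \<subseteq> V \<and> successively (uadj A) (L n)"
    and grow: "\<And>n. \<exists>q. L (Suc n) = L n @ q \<and> set q \<inter> F \<noteq> {} \<and> set q \<inter> G \<noteq> {}"
  shows "\<exists>h. is_ray V A h \<and> infinite (range h \<inter> F) \<and> infinite (range h \<inter> G)"
proof -
  have len: "n \<le> length (L n)" for n
  proof (induction n)
    case (Suc n)
    obtain q where "L (Suc n) = L n @ q" "set q \<inter> F \<noteq> {}" using grow by blast
    then have "length (L (Suc n)) > length (L n)" by (cases q) auto
    then show ?case using Suc by simp
  qed simp
  have pre: "\<exists>q. L (n + k) = L n @ q" for n k
  proof (induction k)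
    case (Suc k)
    then show ?case using grow[of "n + k"] by auto
  qed simp
  have nth: "L m ! i = L n ! i" if "i < length (L n)" "n \<le> m" for m n i
    using pre[of n "m - n"] that by (auto simp: nth_append)
  \<comment> \<open>The vertex with index \<open>i\<close> is already fixed in
    \<open>L (Suc i)\<close>, since every extension adds at least one vertex.\<close>
  define h where "h i = L (Suc i) ! i" for i
  have h: "h i = L n ! i" if "i < length (L n)" for n i
  proof (cases "n \<le> Suc i")
    case True
    then show ?thesis unfolding h_def by (rule nth[OF that])
  next
    case False
    have "i < length (L (Suc i))" using len[of "Suc i"] by simp
    moreover have "Suc i \<le> n" using False by simp
    ultimately show ?thesis unfolding h_def by (rule nth[symmetric])
  qed
  have hh: "h i = L (Suc (max i j)) ! i \<and> i < length (L (Suc (max i j))) \<and>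
    h j = L (Suc (max i j)) ! j \<and> j < length (L (Suc (max i j)))" for i j
    using h[of i "Suc (max i j)"] h[of j "Suc (max i j)"] len[of "Suc (max i j)"] by auto
  have inj: "inj h"
  proof (rule injI)
    fix i j assume "h i = h j"
    then show "i = j"
      using hh[of i j] L[of "Suc (max i j)"] nth_eq_iff_index_eq[of "L (Suc (max i j))" i j] by simp
  qed
  have ray: "is_ray V A h"
    unfolding is_ray_def
  proof (intro conjI allI)
    show "range h \<subseteq> V"
    proof
      fix y assume "y \<in> range h"
      then obtain i where "y = h i" by blast
      then have "y \<in> set (L (Suc i))" using hh[of i i] by auto
      then show "y \<in> V" using L by blast
    qed
    show "uadj A (h n) (h (Suc n))" for n
    proof -
      have "Suc n < length (L (Suc (Suc n)))" using len[of "Suc (Suc n)"] by simp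
      then show ?thesis
        using L[of "Suc (Suc n)"] h[of n "Suc (Suc n)"] h[of "Suc n" "Suc (Suc n)"]
        by (auto simp: successively_conv_nth)
    qed
  qed (rule inj)
  have inf: "infinite (range h \<inter> H)" if H: "\<And>n. \<exists>q. L (Suc n) = L n @ q \<and> set q \<inter> H \<noteq> {}" for H
  proof -
    have "\<exists>i\<ge>n. h i \<in> H" for n
    proof -
      obtain q where q: "L (Suc n) = L n @ q" "set q \<inter> H \<noteq> {}" using H by blast
      then obtain j where j: "j < length q" "q ! j \<in> H" by (auto simp: in_set_conv_nth)
      then have "h (length (L n) + j) = q ! j"
        using h[of "length (L n) + j" "Suc n"] q by (simp add: nth_append)
      then show ?thesis using j len[of n] by (intro exI[of _ "length (L n) + j"]) auto
    qed
    then have "infinite {i. h i \<in> H}" by (auto simp: finite_nat_set_iff_bounded not_less)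
    then have "infinite (h ` {i. h i \<in> H})" using inj by (auto dest: finite_imageD intro: inj_on_subset)
    then show ?thesis by (rule infinite_super[rotated]) auto
  qed
  show ?thesis
    using ray inf[of F] inf[of G] grow by (intro exI[of _ h]) blast
qed

text \<open>Used in contrapositive form: disjoint rays that are not equivalent are separated by a
  finite set. Two alternating extensions make one round, so that every round hits both rays.\<close>

lemma inseparable_rays_equiv:
  assumes f: "is_ray V A f" and g: "is_ray V A g" and fg: "range f \<inter> range g = {}"
    and linked: "\<And>S. finite S \<Longrightarrow>
      \<exists>m n. f m \<notin> S \<and> (\<lambda>u v. u \<in> V - S \<and> v \<in> V - S \<and> uadj A u v)\<^sup>*\<^sup>* (f m) (g n)"
  shows "ray_equiv V A f g"
proof -
  have linked': "\<exists>m n. g m \<notin> S \<and> (\<lambda>u v. u \<in> V - S \<and> v \<in> V - S \<and> uadj A u v)\<^sup>*\<^sup>* (g m) (f n)"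
    if S: "finite S" for S
  proof -
    let ?R = "\<lambda>u v. u \<in> V - S \<and> v \<in> V - S \<and> uadj A u v"
    obtain m n where mn: "f m \<notin> S" "?R\<^sup>*\<^sup>* (f m) (g n)" using linked[OF S] by blast
    have "?R\<^sup>*\<^sup>* (g n) (f m)"
      using sympD[OF symp_rtranclp[of ?R]] mn(2) by (auto simp: symp_def uadj_sym)
    moreover have "g n \<notin> S"
      using mn fg by (metis (no_types, lifting) DiffE disjoint_iff rangeI rtranclp.cases)
    ultimately show ?thesis by blast
  qed
  let ?P = "\<lambda>p. ray_head (uadj A) V f g p"
  have "\<exists>L. \<forall>n. ?P (L n) \<and> (\<exists>q. L (Suc n) = L n @ q \<and> set q \<inter> range f \<noteq> {} \<and> set q \<inter> range g \<noteq> {})"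
  proof (rule dependent_nat_choice)
    show "\<exists>p. ?P p"
      using f fg unfolding ray_head_def is_ray_def
      by (intro exI[of _ "[f 0]"]) (auto simp: inj_eq intro!: exI[of _ 0])
    fix p assume "?P p"
    then obtain q where q: "q \<noteq> []" "ray_head (uadj A) V g f (p @ q)"
      using ray_head_extend[OF f g fg linked] by blast
    then obtain s where s: "s \<noteq> []" "ray_head (uadj A) V f g ((p @ q) @ s)"
      using ray_head_extend[OF g f _ linked'] fg by (metis Int_commute)
    have "last q \<in> set (q @ s) \<inter> range g" "last s \<in> set (q @ s) \<inter> range f"
      using q s by (auto simp: ray_head_def)
    then have "set (q @ s) \<inter> range f \<noteq> {}" "set (q @ s) \<inter> range g \<noteq> {}" by blast+
    then show "\<exists>p'. ?P p' \<and> (\<exists>q. p' = p @ q \<and> set q \<inter> range f \<noteq> {} \<and> set q \<inter> range g \<noteq> {})"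
      using s by (metis append.assoc)
  qed
  then obtain L where "\<And>n. ?P (L n)"
    "\<And>n. \<exists>q. L (Suc n) = L n @ q \<and> set q \<inter> range f \<noteq> {} \<and> set q \<inter> range g \<noteq> {}" by blast
  then show ?thesis
    unfolding ray_equiv_def by (intro ray_from_growing_paths[of L]) (auto simp: ray_head_def)
qed

lemma is_ray_shift: "is_ray V A f \<Longrightarrow> is_ray V A (\<lambda>n. f (n + k))"
  by (auto simp: is_ray_def inj_eq intro!: injI)

lemma ray_equiv_shift:
  assumes "ray_equiv V A (\<lambda>n. f (n + k)) g"
  shows "ray_equiv V A f g"
proof -
  obtain h where h: "is_ray V A h" "infinite (range h \<inter> range (\<lambda>n. f (n + k)))" "infinite (range h \<inter> range g)"
    using assms unfolding ray_equiv_def by blast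
  have "range h \<inter> range (\<lambda>n. f (n + k)) \<subseteq> range h \<inter> range f" by auto
  then show ?thesis unfolding ray_equiv_def using h by (meson infinite_super)
qed

lemma finite_cut_of_ends:
  assumes dg: "digraph V A" and lf: "locally_finite V A" and ends: "more_than_one_end V A"
  shows "\<exists>C\<subseteq>V. infinite C \<and> infinite (V - C) \<and> finite {(u, v). u \<in> C \<and> v \<notin> C \<and> uadj A u v}"
proof -
  obtain f0 g where f0: "is_ray V A f0" and g: "is_ray V A g" and ne0: "\<not> ray_equiv V A f0 g"
    using ends unfolding more_than_one_end_def by blast
  \<comment> \<open>Otherwise \<open>f0\<close> itself would be a ray meeting both infinitely
    often.\<close>
  have fin: "finite (range f0 \<inter> range g)"
    using ne0 f0 infinite_range_inj unfolding ray_equiv_def is_ray_def by (metis Int_absorb)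
  have "finite (f0 -` (range f0 \<inter> range g))"
    using fin f0 by (intro finite_vimageI) (auto simp: is_ray_def)
  then obtain k where k: "\<And>i. f0 i \<in> range g \<Longrightarrow> i < k"
    unfolding finite_nat_set_iff_bounded by blast
  define f where "f n = f0 (n + k)" for n
  have f: "is_ray V A f" using is_ray_shift[OF f0] by (simp add: f_def[abs_def])
  have ne: "\<not> ray_equiv V A f g" using ray_equiv_shift[of V A f0 k g] ne0 by (auto simp: f_def[abs_def])
  have fg: "range f \<inter> range g = {}"
    using k by (fastforce simp: f_def)
  obtain S where S: "finite S" and sep: "\<And>m n. f m \<notin> S \<Longrightarrow>
    \<not> (\<lambda>u v. u \<in> V - S \<and> v \<in> V - S \<and> uadj A u v)\<^sup>*\<^sup>* (f m) (g n)"
    using inseparable_rays_equiv[OF f g fg] ne by blast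
  let ?R = "\<lambda>u v. u \<in> V - S \<and> v \<in> V - S \<and> uadj A u v"
  \<comment> \<open>The union of the components outside \<open>S\<close> that meet \<open>f\<close>.
    An edge leaving it must end in \<open>S\<close>, and local finiteness leaves only finitely many
    such edges.\<close>
  define C where "C = {v. \<exists>m. f m \<notin> S \<and> ?R\<^sup>*\<^sup>* (f m) v}"
  have rf: "range f \<subseteq> V" "range g \<subseteq> V" "inj f" "inj g" using f g by (auto simp: is_ray_def)
  have CV: "C \<subseteq> V - S"
  proof
    fix v assume "v \<in> C"
    then obtain m where "f m \<notin> S" "?R\<^sup>*\<^sup>* (f m) v" unfolding C_def by blast
    then show "v \<in> V - S" using rf by (cases rule: rtranclp.cases[OF \<open>?R\<^sup>*\<^sup>* (f m) v\<close>]) auto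
  qed
  have "range f - S \<subseteq> C" by (auto simp: C_def)
  moreover have "infinite (range f - S)" using rf S by (simp add: infinite_range_inj)
  ultimately have infC: "infinite C" using infinite_super by blast
  have "range g - S \<subseteq> V - C" using sep rf by (auto simp: C_def)
  moreover have "infinite (range g - S)" using rf S by (simp add: infinite_range_inj)
  ultimately have infC': "infinite (V - C)" using infinite_super by blast
  have "{(u, v). u \<in> C \<and> v \<notin> C \<and> uadj A u v} \<subseteq> (\<Union>v\<in>S \<inter> V. ({y. A v y} \<union> {y. A y v}) \<times> {v})"
  proof clarify
    fix u v assume uv: "u \<in> C" "v \<notin> C" "uadj A u v"
    have "v \<in> V" using uv(3) dg by (auto simp: digraph_def uadj_def)
    moreover have "v \<in> S"
    proof (rule ccontr)
      assume "v \<notin> S"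
      then have "?R u v" using uv CV \<open>v \<in> V\<close> by auto
      moreover obtain m where "f m \<notin> S" "?R\<^sup>*\<^sup>* (f m) u" using uv(1) unfolding C_def by blast
      ultimately have "v \<in> C" unfolding C_def using rtranclp.rtrancl_into_rtrancl[of ?R "f m" u v] by blast
      then show False using uv by simp
    qed
    ultimately show "(u, v) \<in> (\<Union>v\<in>S \<inter> V. ({y. A v y} \<union> {y. A y v}) \<times> {v})"
      using uv by (auto simp: uadj_def)
  qed
  moreover have "finite (\<Union>v\<in>S \<inter> V. ({y. A v y} \<union> {y. A y v}) \<times> {v})"
    using S lf by (auto simp: locally_finite_def)
  ultimately have "finite {(u, v). u \<in> C \<and> v \<notin> C \<and> uadj A u v}" using finite_subset by blast
  then show ?thesis using CV infC infC' by blast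
qed

section \<open>Nested cuts\<close>

definition edge_bd :: "('a \<Rightarrow> 'a \<Rightarrow> bool) \<Rightarrow> 'a set \<Rightarrow> ('a \<times> 'a) set" where
  "edge_bd E C = {(u, v). u \<in> C \<and> v \<notin> C \<and> E u v}"

definition conn_in :: "('a \<Rightarrow> 'a \<Rightarrow> bool) \<Rightarrow> 'a set \<Rightarrow> bool" where
  "conn_in E C \<longleftrightarrow> (\<forall>u\<in>C. \<forall>v\<in>C. (\<lambda>a b. a \<in> C \<and> b \<in> C \<and> E a b)\<^sup>*\<^sup>* u v)"

lemma finite_separating_trans:
  assumes "R\<^sup>*\<^sup>* u v" and "\<And>a b. R a b \<Longrightarrow> finite {C \<in> \<C>. a \<in> C \<and> b \<notin> C}"
  shows "finite {C \<in> \<C>. u \<in> C \<and> v \<notin> C}"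
  using assms(1)
proof (induction rule: rtranclp_induct)
  case base
  then show ?case by (simp add: conj_commute[of "u \<in> _"])
next
  case (step y z)
  have "{C \<in> \<C>. u \<in> C \<and> z \<notin> C} \<subseteq> {C \<in> \<C>. u \<in> C \<and> y \<notin> C} \<union> {C \<in> \<C>. y \<in> C \<and> z \<notin> C}" by auto
  then show ?case using step assms(2) by (meson finite_UnI finite_subset)
qed

text \<open>Deleting an edge of a tight cut gives a tight cut with one boundary edge less, which must
  contain another edge of any fixed path joining the ends of the deleted edge.\<close>

lemma finite_tight_cuts:
  assumes "E x y" "\<And>u v. E u v \<Longrightarrow> E v u" "\<And>u v. E u v \<Longrightarrow> u \<in> V \<and> v \<in> V"
  shows "finite {C. C \<subseteq> V \<and> conn_in E C \<and> conn_in E (V - C) \<and> finite (edge_bd E C) \<and>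
    card (edge_bd E C) = k \<and> x \<in> C \<and> y \<notin> C}"
  using assms
proof (induction k arbitrary: E x y)
  case 0
  then have "{C. C \<subseteq> V \<and> conn_in E C \<and> conn_in E (V - C) \<and> finite (edge_bd E C) \<and>
    card (edge_bd E C) = 0 \<and> x \<in> C \<and> y \<notin> C} = {}"
    by (auto simp: card_eq_0_iff) (auto simp: edge_bd_def)
  then show ?case by (metis finite.emptyI)
next
  case (Suc k)
  define E' where "E' a b \<longleftrightarrow> E a b \<and> (a, b) \<noteq> (x, y) \<and> (a, b) \<noteq> (y, x)" for a b
  define \<C> where "\<C> = {C. C \<subseteq> V \<and> conn_in E' C \<and> conn_in E' (V - C) \<and> finite (edge_bd E' C) \<and>
    card (edge_bd E' C) = k}"
  let ?T = "{C. C \<subseteq> V \<and> conn_in E C \<and> conn_in E (V - C) \<and> finite (edge_bd E C) \<and>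
    card (edge_bd E C) = Suc k \<and> x \<in> C \<and> y \<notin> C}"
  have conn: "conn_in E' D" if "conn_in E D" "\<not> (x \<in> D \<and> y \<in> D)" for D
  proof -
    have "(\<lambda>a b. a \<in> D \<and> b \<in> D \<and> E a b) = (\<lambda>a b. a \<in> D \<and> b \<in> D \<and> E' a b)"
      using that(2) by (auto simp: E'_def fun_eq_iff)
    then show ?thesis using that(1) by (simp add: conn_in_def)
  qed
  have TC: "C \<in> \<C>" if "C \<in> ?T" for C
  proof -
    have "edge_bd E' C = edge_bd E C - {(x, y)}" "(x, y) \<in> edge_bd E C"
      using that Suc.prems by (auto simp: edge_bd_def E'_def)
    then show ?thesis using that conn[of C] conn[of "V - C"] by (auto simp: \<C>_def)
  qed
  have E'1: "E' u v \<Longrightarrow> E' v u" and E'2: "E' u v \<Longrightarrow> u \<in> V \<and> v \<in> V" for u v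
    using Suc.prems by (auto simp: E'_def)
  show ?case
  proof (cases "E'\<^sup>*\<^sup>* x y")
    case True
    have "finite {C \<in> \<C>. x \<in> C \<and> y \<notin> C}"
    proof (rule finite_separating_trans[OF True])
      fix a b assume "E' a b"
      then show "finite {C \<in> \<C>. a \<in> C \<and> b \<notin> C}"
        using Suc.IH[of E' a b] E'1 E'2 unfolding \<C>_def by (simp add: conj_assoc)
    qed
    moreover have "?T \<subseteq> {C \<in> \<C>. x \<in> C \<and> y \<notin> C}" using TC by blast
    ultimately show ?thesis by (rule rev_finite_subset)
  next
    case False
    \<comment> \<open>If removing the edge separates its ends, the connected sides are determined:
      \<open>C\<close> must be the component of \<open>x\<close>.\<close>
    have "?T \<subseteq> {{z \<in> V. E'\<^sup>*\<^sup>* x z}}"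
    proof
      fix C assume C: "C \<in> ?T"
      have D: "conn_in E' C" "conn_in E' (V - C)" "C \<subseteq> V" "x \<in> C" "y \<notin> C" "y \<in> V"
        using TC[OF C] C Suc.prems by (auto simp: \<C>_def)
      have reach: "E'\<^sup>*\<^sup>* u v" if "conn_in E' D" "u \<in> D" "v \<in> D" for u v D
        using that unfolding conn_in_def
        by (metis (mono_tags, lifting) mono_rtranclp)
      have "z \<in> C" if "z \<in> V" "E'\<^sup>*\<^sup>* x z" for z
      proof (rule ccontr)
        assume "z \<notin> C"
        then have "E'\<^sup>*\<^sup>* z y" using reach[OF D(2)] that D by blast
        then show False using that(2) False by (meson rtranclp_trans)
      qed
      then have "C = {z \<in> V. E'\<^sup>*\<^sup>* x z}" using reach[OF D(1)] D by blast
      then show "C \<in> {{z \<in> V. E'\<^sup>*\<^sup>* x z}}" by simp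
    qed
    then show ?thesis by (rule finite_subset) simp
  qed
qed

section \<open>Narrow cuts and uncrossing\<close>

locale cut_graph =
  fixes V :: "'a set" and E :: "'a \<Rightarrow> 'a \<Rightarrow> bool"
  assumes E_sym: "E u v \<Longrightarrow> E v u"
    and E_V: "E u v \<Longrightarrow> u \<in> V \<and> v \<in> V"
    and E_conn: "u \<in> V \<Longrightarrow> v \<in> V \<Longrightarrow> E\<^sup>*\<^sup>* u v"
    and ex_cut: "\<exists>C\<subseteq>V. infinite C \<and> infinite (V - C) \<and> finite (edge_bd E C)"
begin

definition is_cut :: "'a set \<Rightarrow> bool" where
  "is_cut C \<longleftrightarrow> C \<subseteq> V \<and> infinite C \<and> infinite (V - C) \<and> finite (edge_bd E C)"

definition min_bd :: nat where
  "min_bd = (LEAST n. \<exists>C. is_cut C \<and> card (edge_bd E C) = n)"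

definition narrow :: "'a set \<Rightarrow> bool" where
  "narrow C \<longleftrightarrow> is_cut C \<and> card (edge_bd E C) = min_bd"

definition nested :: "'a set \<Rightarrow> 'a set \<Rightarrow> bool" where
  "nested C D \<longleftrightarrow> C \<subseteq> D \<or> D \<subseteq> C \<or> C \<inter> D = {} \<or> V \<subseteq> C \<union> D"

definition crossing :: "'a set \<Rightarrow> 'a set set" where
  "crossing C = {D. narrow D \<and> \<not> nested C D}"

text \<open>Minimal boundary alone does not exclude crossing pairs. The second minimum, over the
  number of crossed cuts, does, and both minima are invariant under automorphisms.\<close>

definition opt_cuts :: "'a set set" where
  "opt_cuts = {C. narrow C \<and> (\<forall>D. narrow D \<longrightarrow> card (crossing C) \<le> card (crossing D))}"

lemma ex_narrow: "\<exists>C. narrow C"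
proof -
  have "\<exists>n C. is_cut C \<and> card (edge_bd E C) = n" using ex_cut by (auto simp: is_cut_def)
  from LeastI_ex[OF this] show ?thesis by (auto simp: narrow_def min_bd_def)
qed

lemma min_bd_le: "is_cut C \<Longrightarrow> min_bd \<le> card (edge_bd E C)"
  unfolding min_bd_def by (rule Least_le) blast

lemma edge_bd_compl: "C \<subseteq> V \<Longrightarrow> edge_bd E (V - C) = (edge_bd E C)\<inverse>"
  by (auto simp: edge_bd_def dest: E_V E_sym)

lemma is_cut_compl: "is_cut C \<Longrightarrow> is_cut (V - C)"
  by (auto simp: is_cut_def edge_bd_compl double_diff)

lemma narrow_compl: "narrow C \<Longrightarrow> narrow (V - C)"
  by (auto simp: narrow_def is_cut_compl edge_bd_compl) (simp add: is_cut_def edge_bd_compl)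

lemma edge_bd_nonempty:
  assumes "C \<subseteq> V" "C \<noteq> {}" "C \<noteq> V"
  shows "edge_bd E C \<noteq> {}"
proof
  assume e: "edge_bd E C = {}"
  obtain u v where uv: "u \<in> C" "v \<in> V" "v \<notin> C" using assms by blast
  have "E\<^sup>*\<^sup>* u v" using E_conn uv assms by blast
  then have "v \<in> C" using uv(1) e by (induction rule: rtranclp_induct) (auto simp: edge_bd_def)
  then show False using uv by simp
qed

text \<open>A disconnected side splits into two parts whose boundaries are disjoint nonempty subsets
  of that of \<open>C\<close>; an infinite part would then be a cut with smaller boundary.\<close>

lemma narrow_conn:
  assumes C: "narrow C"
  shows "conn_in E C"
  unfolding conn_in_def
proof (intro ballI)
  fix x y assume xy: "x \<in> C" "y \<in> C"
  let ?R = "\<lambda>a b. a \<in> C \<and> b \<in> C \<and> E a b"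
  define B where "B = {z \<in> C. ?R\<^sup>*\<^sup>* x z}"
  have cut: "C \<subseteq> V" "infinite C" "infinite (V - C)" "finite (edge_bd E C)"
    using C by (auto simp: narrow_def is_cut_def)
  have closed: "z \<in> B" if "u \<in> B" "z \<in> C" "E u z" for u z
    using that unfolding B_def by (auto intro: rtranclp.rtrancl_into_rtrancl)
  have xB: "x \<in> B" using xy by (auto simp: B_def)
  have BC: "B \<subseteq> C" by (auto simp: B_def)
  have "B = C"
  proof (rule ccontr)
    assume "B \<noteq> C"
    then have ne: "B \<noteq> {}" "C - B \<noteq> {}" using xB BC by auto
    have sub: "edge_bd E B \<subseteq> edge_bd E C" "edge_bd E (C - B) \<subseteq> edge_bd E C"
      using closed BC E_sym by (auto simp: edge_bd_def)
    have disj: "edge_bd E B \<inter> edge_bd E (C - B) = {}" by (auto simp: edge_bd_def)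
    have nb: "edge_bd E B \<noteq> {}" "edge_bd E (C - B) \<noteq> {}"
      using ne BC cut by (intro edge_bd_nonempty; auto)+
    have lt: "card (edge_bd E D) < card (edge_bd E C)" if "D = B \<or> D = C - B" for D
      using sub disj nb that cut(4) by (intro psubset_card_mono) blast+
    have "infinite B \<or> infinite (C - B)" using cut(2) by (metis finite_Diff2)
    then obtain D where D: "D = B \<or> D = C - B" "infinite D" by blast
    have "V - C \<subseteq> V - D" using D(1) BC by auto
    then have "is_cut D" unfolding is_cut_def using D cut BC sub
      by (metis Diff_subset finite_subset subset_trans)
    then show False using min_bd_le lt[OF D(1)] C by (metis narrow_def not_less)
  qed
  then show "?R\<^sup>*\<^sup>* x y" using xy by (auto simp: B_def)
qed

lemma finite_narrow_separating:
  assumes "u \<in> V" "v \<in> V"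
  shows "finite {C. narrow C \<and> u \<in> C \<and> v \<notin> C}"
proof -
  have "finite {C \<in> Collect narrow. u \<in> C \<and> v \<notin> C}"
  proof (rule finite_separating_trans[OF E_conn[OF assms]])
    fix a b assume "E a b"
    have "{C \<in> Collect narrow. a \<in> C \<and> b \<notin> C} \<subseteq>
      {C. C \<subseteq> V \<and> conn_in E C \<and> conn_in E (V - C) \<and> finite (edge_bd E C) \<and>
        card (edge_bd E C) = min_bd \<and> a \<in> C \<and> b \<notin> C}"
      using narrow_conn narrow_compl by (auto simp: narrow_def is_cut_def)
    then show "finite {C \<in> Collect narrow. a \<in> C \<and> b \<notin> C}"
      using finite_tight_cuts[of E a b V min_bd] \<open>E a b\<close> E_sym E_V by (metis (no_types, lifting) finite_subset)
  qed
  then show ?thesis by simp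
qed

lemma conn_in_side:
  assumes "conn_in E D" and "\<And>u v. (u, v) \<in> edge_bd E C \<Longrightarrow> u \<notin> D \<or> v \<notin> D"
  shows "D \<subseteq> C \<or> D \<inter> C = {}"
proof (rule ccontr)
  assume "\<not> ?thesis"
  then obtain a b where ab: "a \<in> D" "a \<in> C" "b \<in> D" "b \<notin> C" by blast
  then have "(\<lambda>a b. a \<in> D \<and> b \<in> D \<and> E a b)\<^sup>*\<^sup>* a b" using assms(1) by (auto simp: conn_in_def)
  then have "b \<in> C" using ab(2)
    by (induction rule: rtranclp_induct) (use assms(2) in \<open>auto simp: edge_bd_def\<close>)
  then show False using ab by simp
qed

text \<open>A narrow cut crossing \<open>C\<close> separates two of the finitely many ends of
  boundary edges of \<open>C\<close>: otherwise one of its sides misses all of them and, being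
  connected, lies on one side of \<open>C\<close>.\<close>

lemma finite_crossing:
  assumes C: "narrow C"
  shows "finite (crossing C)"
proof -
  define K where "K = fst ` edge_bd E C \<union> snd ` edge_bd E C"
  have K: "finite K" "K \<subseteq> V"
    using C E_V by (auto simp: K_def narrow_def is_cut_def edge_bd_def)
  have CV: "C \<subseteq> V" "C \<noteq> {}" "C \<noteq> V" using C by (auto simp: narrow_def is_cut_def)
  have "crossing C \<subseteq> (\<Union>u\<in>K. \<Union>v\<in>K. {D. narrow D \<and> u \<in> D \<and> v \<notin> D})"
  proof
    fix D assume D: "D \<in> crossing C"
    then have nD: "narrow D" and DV: "D \<subseteq> V" and nn: "\<not> nested C D"
      by (auto simp: crossing_def narrow_def is_cut_def)
    have "K \<inter> D \<noteq> {}"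
    proof
      assume "K \<inter> D = {}"
      then have "D \<subseteq> C \<or> D \<inter> C = {}"
        using narrow_conn[OF nD] by (intro conn_in_side) (force simp: K_def)+
      then show False using nn by (auto simp: nested_def)
    qed
    moreover have "\<not> K \<subseteq> D"
    proof
      assume "K \<subseteq> D"
      then have "V - D \<subseteq> C \<or> (V - D) \<inter> C = {}"
        using narrow_conn[OF narrow_compl[OF nD]] by (intro conn_in_side) (force simp: K_def)+
      then show False using nn CV by (auto simp: nested_def)
    qed
    ultimately show "D \<in> (\<Union>u\<in>K. \<Union>v\<in>K. {D. narrow D \<and> u \<in> D \<and> v \<notin> D})" using nD by blast
  qed
  then show ?thesis
    using K finite_narrow_separating by (meson finite_UN_I finite_subset subset_iff)
qed

text \<open>Submodularity: an edge leaving \<open>C \<inter> D\<close> or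
  \<open>C \<union> D\<close> leaves \<open>C\<close> or \<open>D\<close>, and one leaving both the
  former leaves both the latter. So the two new boundaries have at most \<open>2 * min_bd\<close>
  edges in total, while neither has fewer than \<open>min_bd\<close>.\<close>

lemma narrow_corners:
  assumes C: "narrow C" and D: "narrow D" and inf: "infinite (C \<inter> D)" "infinite (V - (C \<union> D))"
  shows "narrow (C \<inter> D) \<and> narrow (C \<union> D)"
proof -
  let ?b = "edge_bd E"
  have fin: "finite (?b C)" "finite (?b D)" and CD: "C \<subseteq> V" "D \<subseteq> V"
    using C D by (auto simp: narrow_def is_cut_def)
  have sub: "?b (C \<inter> D) \<union> ?b (C \<union> D) \<subseteq> ?b C \<union> ?b D" "?b (C \<inter> D) \<inter> ?b (C \<union> D) \<subseteq> ?b C \<inter> ?b D"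
    by (auto simp: edge_bd_def)
  have fin': "finite (?b (C \<inter> D))" "finite (?b (C \<union> D))"
    using sub(1) fin by (meson finite_UnI finite_subset le_sup_iff)+
  have cuts: "is_cut (C \<inter> D)" "is_cut (C \<union> D)"
    using inf CD fin' unfolding is_cut_def
    by (auto dest: finite_subset[of "V - (C \<union> D)" "V - C \<inter> D", rotated])
  have "card (?b (C \<inter> D)) + card (?b (C \<union> D)) \<le> card (?b C) + card (?b D)"
    using card_Un_Int[OF fin'] card_Un_Int[OF fin] card_mono[OF _ sub(1)] card_mono[OF _ sub(2)] fin by simp
  then show ?thesis
    using min_bd_le[OF cuts(1)] min_bd_le[OF cuts(2)] C D cuts by (auto simp: narrow_def)
qed

text \<open>The submodular count again, with crossed cuts in place of edges. It is strict because
  \<open>C\<close> crosses \<open>D\<close> but is nested with both the intersection and the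
  union.\<close>

lemma crossing_corners:
  assumes C: "narrow C" and D: "narrow D" and cr: "\<not> nested C D"
    and inf: "infinite (C \<inter> D)" "infinite (V - (C \<union> D))"
  shows "card (crossing (C \<inter> D)) + card (crossing (C \<union> D)) < card (crossing C) + card (crossing D)"
proof -
  have CD: "C \<subseteq> V" "D \<subseteq> V" using C D by (auto simp: narrow_def is_cut_def)
  note nar = narrow_corners[OF C D inf]
  note fin = finite_crossing[OF C] finite_crossing[OF D]
  note fin' = finite_crossing[OF conjunct1[OF nar]] finite_crossing[OF conjunct2[OF nar]]
  have V: "B \<subseteq> V" if "narrow B" for B using that by (auto simp: narrow_def is_cut_def)
  have 1: "crossing (C \<inter> D) \<union> crossing (C \<union> D) \<subseteq> (crossing C \<union> crossing D) - {C}"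
  proof
    fix B assume B: "B \<in> crossing (C \<inter> D) \<union> crossing (C \<union> D)"
    then have nB: "narrow B" by (auto simp: crossing_def)
    have "\<not> nested C B \<or> \<not> nested D B"
    proof (rule ccontr)
      assume "\<not> ?thesis"
      then have n: "nested C B" "nested D B" by auto
      then have "nested (C \<inter> D) B" "nested (C \<union> D) B"
        using cr CD V[OF nB] unfolding nested_def by blast+
      then show False using B by (auto simp: crossing_def)
    qed
    moreover have "B \<noteq> C" using B by (auto simp: crossing_def nested_def)
    ultimately show "B \<in> (crossing C \<union> crossing D) - {C}" using nB by (auto simp: crossing_def)
  qed
  have 2: "crossing (C \<inter> D) \<inter> crossing (C \<union> D) \<subseteq> crossing C \<inter> crossing D"
    using CD V unfolding crossing_def nested_def by blast
  have "C \<in> crossing D" using C cr by (auto simp: crossing_def nested_def)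
  then have "crossing (C \<inter> D) \<union> crossing (C \<union> D) \<subset> crossing C \<union> crossing D" using 1 by blast
  then have "card (crossing (C \<inter> D) \<union> crossing (C \<union> D)) < card (crossing C \<union> crossing D)"
    using fin by (simp add: psubset_card_mono)
  then show ?thesis
    using card_Un_Int[OF fin] card_Un_Int[OF fin'] card_mono[OF _ 2] fin by simp
qed

lemma nested_compl: "C \<subseteq> V \<Longrightarrow> D \<subseteq> V \<Longrightarrow> nested (V - C) D \<longleftrightarrow> nested C D"
  unfolding nested_def by blast

lemma nested_sym: "nested C D \<longleftrightarrow> nested D C"
  unfolding nested_def by blast

lemma crossing_compl: "narrow C \<Longrightarrow> crossing (V - C) = crossing C"
  unfolding crossing_def by (auto simp: nested_compl narrow_def is_cut_def)

lemma opt_cuts_compl: "C \<in> opt_cuts \<Longrightarrow> V - C \<in> opt_cuts"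
  by (auto simp: opt_cuts_def narrow_compl crossing_compl)

text \<open>Two opposite corners are infinite: if one corner is finite, both corners next to it are
  infinite, as all four sides are. Replacing \<open>D\<close> by its complement exchanges the two
  pairs of opposite corners, and the strict inequality for crossings contradicts optimality.\<close>

lemma opt_cuts_nested:
  assumes "C \<in> opt_cuts" "D \<in> opt_cuts"
  shows "nested C D"
proof (rule ccontr)
  assume cr: "\<not> nested C D"
  have no: False if C: "C \<in> opt_cuts" and D: "D \<in> opt_cuts" and "\<not> nested C D"
    and inf: "infinite (C \<inter> D)" "infinite (V - (C \<union> D))" for C D
  proof -
    have "narrow C" "narrow D" using C D by (auto simp: opt_cuts_def)
    note nar = narrow_corners[OF this inf] and lt = crossing_corners[OF this that(3) inf]
    have "card (crossing C) \<le> card (crossing (C \<inter> D))" "card (crossing D) \<le> card (crossing (C \<union> D))"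
      using nar C D by (auto simp: opt_cuts_def)
    then show False using lt by simp
  qed
  have V: "C \<subseteq> V" "D \<subseteq> V" and inf: "infinite C" "infinite D" "infinite (V - C)" "infinite (V - D)"
    using assms by (auto simp: opt_cuts_def narrow_def is_cut_def)
  show False
  proof (cases "infinite (C \<inter> D) \<and> infinite (V - (C \<union> D))")
    case True
    then show ?thesis using no[OF assms cr] by blast
  next
    case False
    have e: "C = C \<inter> D \<union> C \<inter> (V - D)" "D = C \<inter> D \<union> (V - (C \<union> (V - D)))"
      "V - C = (V - (C \<union> D)) \<union> (V - (C \<union> (V - D)))" "V - D = (V - (C \<union> D)) \<union> C \<inter> (V - D)"
      using V by blast+
    have "infinite (C \<inter> (V - D))" "infinite (V - (C \<union> (V - D)))"
      using False inf e by (metis finite_UnI)+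
    moreover have "\<not> nested C (V - D)" using cr V by (metis nested_compl nested_sym)
    ultimately show ?thesis using no[OF assms(1) opt_cuts_compl[OF assms(2)]] by blast
  qed
qed

lemma ex_opt_cut: "opt_cuts \<noteq> {}"
proof -
  obtain C where "narrow C" "\<forall>D. narrow D \<longrightarrow> card (crossing C) \<le> card (crossing D)"
    using ex_narrow ex_has_least_nat[of narrow _ "\<lambda>C. card (crossing C)"] by blast
  then show ?thesis by (auto simp: opt_cuts_def)
qed

lemma finite_opt_cuts_separating:
  "u \<in> V \<Longrightarrow> v \<in> V \<Longrightarrow> finite {C \<in> opt_cuts. u \<in> C \<and> v \<notin> C}"
  by (rule finite_subset[OF _ finite_narrow_separating[of u v]]) (auto simp: opt_cuts_def)

section \<open>Invariance of the optimal cuts under automorphisms\<close>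

definition aut :: "('a \<Rightarrow> 'a) \<Rightarrow> bool" where
  "aut g \<longleftrightarrow> bij_betw g V V \<and> (\<forall>x\<in>V. \<forall>y\<in>V. E x y \<longleftrightarrow> E (g x) (g y))"

lemma aut_inv:
  assumes "aut g"
  shows "aut (inv_into V g)"
proof -
  have b: "bij_betw g V V" and E: "\<And>x y. x \<in> V \<Longrightarrow> y \<in> V \<Longrightarrow> E x y \<longleftrightarrow> E (g x) (g y)"
    using assms by (auto simp: aut_def)
  have b': "bij_betw (inv_into V g) V V" using b by (rule bij_betw_inv_into)
  then have "E x y \<longleftrightarrow> E (inv_into V g x) (inv_into V g y)" if "x \<in> V" "y \<in> V" for x y
    using E[of "inv_into V g x" "inv_into V g y"] that b
    by (auto simp: bij_betw_inv_into_right dest: bij_betwE)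
  then show ?thesis using b' by (auto simp: aut_def)
qed

lemma aut_narrow:
  assumes g: "aut g" and C: "narrow C"
  shows "narrow (g ` C)"
proof -
  have inj: "inj_on g V" and im: "g ` V = V" and E: "\<And>x y. x \<in> V \<Longrightarrow> y \<in> V \<Longrightarrow> E x y \<longleftrightarrow> E (g x) (g y)"
    using g by (auto simp: aut_def bij_betw_def)
  have CV: "C \<subseteq> V" using C by (auto simp: narrow_def is_cut_def)
  have Cg: "V - g ` C = g ` (V - C)" using inj im CV by (metis Diff_subset inj_on_image_set_diff)
  have mem: "g x \<in> g ` C \<longleftrightarrow> x \<in> C" if "x \<in> V" for x
    using inj CV that by (metis inj_on_image_mem_iff)
  have bd: "edge_bd E (g ` C) = map_prod g g ` edge_bd E C"
  proof
    show "edge_bd E (g ` C) \<subseteq> map_prod g g ` edge_bd E C"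
    proof clarify
      fix u v assume "(u, v) \<in> edge_bd E (g ` C)"
      then have uv: "u \<in> g ` C" "v \<notin> g ` C" "E u v" by (auto simp: edge_bd_def)
      then obtain a b where "u = g a" "v = g b" "a \<in> C" "b \<in> V" using E_V im by blast
      then have "(a, b) \<in> edge_bd E C" using uv E CV by (auto simp: edge_bd_def)
      then show "(u, v) \<in> map_prod g g ` edge_bd E C" using \<open>u = g a\<close> \<open>v = g b\<close> by force
    qed
    show "map_prod g g ` edge_bd E C \<subseteq> edge_bd E (g ` C)"
    proof (rule image_subsetI)
      fix p assume "p \<in> edge_bd E C"
      then obtain u v where "p = (u, v)" "u \<in> C" "v \<notin> C" "E u v" by (auto simp: edge_bd_def)
      then show "map_prod g g p \<in> edge_bd E (g ` C)"
        using E[of u v] mem[of v] E_V[of u v] by (simp add: edge_bd_def)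
    qed
  qed
  have "inj_on (map_prod g g) (edge_bd E C)"
    using E_V by (intro inj_on_subset[OF map_prod_inj_on[OF inj inj]]) (auto simp: edge_bd_def)
  then have card: "card (edge_bd E (g ` C)) = card (edge_bd E C)" unfolding bd by (rule card_image)
  have "infinite (g ` C)" "infinite (g ` (V - C))"
    using C inj CV by (auto simp: narrow_def is_cut_def finite_image_iff inj_on_diff dest: inj_on_subset)
  moreover have "g ` C \<subseteq> V" using CV im by blast
  ultimately show ?thesis
    using C card bd Cg by (auto simp: narrow_def is_cut_def)
qed

lemma aut_nested:
  assumes "aut g" "C \<subseteq> V" "D \<subseteq> V"
  shows "nested (g ` C) (g ` D) \<longleftrightarrow> nested C D"
proof -
  have inj: "inj_on g V" and im: "g ` V = V" using assms by (auto simp: aut_def bij_betw_def)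
  have 1: "g ` X \<subseteq> g ` Y \<longleftrightarrow> X \<subseteq> Y" if "X \<subseteq> V" "Y \<subseteq> V" for X Y
    using inj_on_image_mem_iff[OF inj _ that(2)] that by blast
  have 2: "g ` C \<inter> g ` D = g ` (C \<inter> D)" using inj assms by (metis inj_on_image_Int)
  have "V \<subseteq> g ` C \<union> g ` D \<longleftrightarrow> V \<subseteq> C \<union> D"
    using 1[of V "C \<union> D"] assms im by (simp add: image_Un)
  then show ?thesis using 1 2 assms by (simp add: nested_def)
qed

lemma aut_crossing_le:
  assumes g: "aut g" and C: "narrow C"
  shows "card (crossing C) \<le> card (crossing (g ` C))"
proof (rule card_inj_on_le)
  have inj: "inj_on g V" using g by (auto simp: aut_def bij_betw_def)
  have V: "B \<subseteq> V" if "narrow B" for B using that by (auto simp: narrow_def is_cut_def)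
  show "inj_on ((`) g) (crossing C)"
    using inj V by (intro inj_on_subset[OF inj_on_image_Pow[OF inj]]) (auto simp: crossing_def)
  show "(`) g ` crossing C \<subseteq> crossing (g ` C)"
    using aut_narrow[OF g] aut_nested[OF g] V C by (auto simp: crossing_def)
  show "finite (crossing (g ` C))" using finite_crossing aut_narrow[OF g C] by blast
qed

lemma aut_opt_cuts:
  assumes g: "aut g" and C: "C \<in> opt_cuts"
  shows "g ` C \<in> opt_cuts"
proof -
  have nC: "narrow C" and CV: "C \<subseteq> V" using C by (auto simp: opt_cuts_def narrow_def is_cut_def)
  \<comment> \<open>Passing to an image cannot lower the number of crossed cuts; the inverse
    automorphism gives the opposite bound, which optimality of the image needs.\<close>
  have "inv_into V g ` (g ` C) = C"
    using g CV by (auto simp: aut_def bij_betw_def intro: inv_into_image_cancel)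
  then have "card (crossing (g ` C)) \<le> card (crossing C)"
    using aut_crossing_le[OF aut_inv[OF g] aut_narrow[OF g nC]] by simp
  then show ?thesis using C aut_narrow[OF g nC] unfolding opt_cuts_def by fastforce
qed

end

section \<open>Orientations of the cut system\<close>

text \<open>Ordered pairs are counted as diagonal, arcs and reversed arcs. This supplies the oddness
  for the parity argument.\<close>

lemma card_regular_tournament:
  assumes fin: "finite S" and irr: "\<And>u. \<not> A u u" and anti: "\<And>u v. A u v \<Longrightarrow> \<not> A v u"
    and tot: "\<And>u v. u \<in> S \<Longrightarrow> v \<in> S \<Longrightarrow> u \<noteq> v \<Longrightarrow> A u v \<or> A v u"
    and reg: "\<And>u. u \<in> S \<Longrightarrow> card {v \<in> S. A u v} = d" and ne: "S \<noteq> {}"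
  shows "card S = 2 * d + 1"
proof -
  define R where "R = Sigma S (\<lambda>u. {v \<in> S. A u v})"
  have finR: "finite R" using fin by (auto simp: R_def)
  have cR: "card R = card S * d" unfolding R_def using fin reg by (simp add: card_SigmaI)
  have eq: "S \<times> S = Id_on S \<union> (R \<union> R\<inverse>)" using tot by (auto simp: R_def)
  have "card (S \<times> S) = card (Id_on S) + card (R \<union> R\<inverse>)"
    unfolding eq by (rule card_Un_disjoint) (use fin finR irr in \<open>auto simp: R_def Id_on_def\<close>)
  also have "card (R \<union> R\<inverse>) = card R + card (R\<inverse>)"
    by (rule card_Un_disjoint) (use finR anti in \<open>auto simp: R_def\<close>)
  also have "card (Id_on S) = card S"
    by (rule bij_betw_same_card[of fst]) (auto simp: bij_betw_def inj_on_def Id_on_def image_iff)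
  finally have "card S * card S = card S * (2 * d + 1)"
    using cR by (simp add: card_cartesian_product algebra_simps)
  then show ?thesis using ne fin by (metis card_0_eq mult_left_cancel)
qed

text \<open>A cut and its complement stand for the two orientations of one edge of the structure
  tree; \<open>nest\<close> is what makes it a tree, and \<open>fin_sep\<close> keeps its paths
  finite.\<close>

locale homogeneous_cut_system =
  fixes V :: "'a set" and A :: "'a \<Rightarrow> 'a \<Rightarrow> bool" and \<E> :: "'a set set"
  assumes dg: "digraph V A" and con: "connected_digraph V A" and lf: "locally_finite V A"
    and hom: "connected_homogeneous V A" and tri: "embeds_triangle V A"
    and cut: "e \<in> \<E> \<Longrightarrow> e \<subseteq> V \<and> infinite e \<and> infinite (V - e) \<and> finite (edge_bd (uadj A) e)"
    and ne: "\<E> \<noteq> {}"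
    and compl: "e \<in> \<E> \<Longrightarrow> V - e \<in> \<E>"
    and nest: "e \<in> \<E> \<Longrightarrow> f \<in> \<E> \<Longrightarrow> e \<subseteq> f \<or> f \<subseteq> e \<or> e \<inter> f = {} \<or> V \<subseteq> e \<union> f"
    and fin_sep: "x \<in> V \<Longrightarrow> y \<in> V \<Longrightarrow> finite {e \<in> \<E>. x \<in> e \<and> y \<notin> e}"
    and aut_inv: "automorphism V A g \<Longrightarrow> e \<in> \<E> \<Longrightarrow> g ` e \<in> \<E>"
begin

section \<open>Transitivity on vertices, arcs and pairs of neighbours\<close>

abbreviation adj where "adj \<equiv> uadj A"

lemma arc_V: "A x y \<Longrightarrow> x \<in> V \<and> y \<in> V" and arc_irr: "\<not> A x x" and arc_anti: "A x y \<Longrightarrow> \<not> A y x"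
  using dg unfolding digraph_def by blast+

lemma adj_V: "adj x y \<Longrightarrow> x \<in> V \<and> y \<in> V" and adj_irr: "\<not> adj x x" and adj_sym: "adj x y \<Longrightarrow> adj y x"
  using arc_V arc_irr by (auto simp: uadj_def)

lemma adj_conn:
  assumes "x \<in> V" "y \<in> V" shows "adj\<^sup>*\<^sup>* x y"
proof -
  have "(\<lambda>u v. u \<in> V \<and> v \<in> V \<and> adj u v)\<^sup>*\<^sup>* x y"
    using con assms by (auto simp: connected_digraph_def uconnected_on_def)
  then show ?thesis by (rule rtranclp_mono[THEN predicate2D, rotated]) auto
qed

lemma adj_invariant_const:
  assumes "\<And>x y. adj x y \<Longrightarrow> P x = P y" "x \<in> V" "y \<in> V"
  shows "P x = P y"
  using adj_conn[OF assms(2,3)] by (induction rule: rtranclp_induct) (auto simp: assms(1))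

lemma vertex_transitive:
  assumes "x \<in> V" "y \<in> V"
  obtains g where "automorphism V A g" "g x = y"
proof -
  have "\<exists>g. automorphism V A g \<and> (\<forall>u\<in>{x}. g u = (\<lambda>_. y) u)"
    using hom[unfolded connected_homogeneous_def, rule_format, of "{x}" "{y}" "\<lambda>_. y"] assms arc_irr
    by (auto simp: uconnected_on_def bij_betw_def)
  then show ?thesis using that by auto
qed

text \<open>A vertex together with two neighbours is always a connected set, so homogeneity applies
  whether the neighbours are adjacent or not. The case \<open>y = z\<close> gives
  arc-transitivity.\<close>

lemma triple_transitive:
  assumes "adj x y" "adj x z" "adj x' y'" "adj x' z'"
    and "A x y \<longleftrightarrow> A x' y'" "A x z \<longleftrightarrow> A x' z'" "A y z \<longleftrightarrow> A y' z'" "A z y \<longleftrightarrow> A z' y'" "y = z \<longleftrightarrow> y' = z'"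
  obtains g where "automorphism V A g" "g x = x'" "g y = y'" "g z = z'"
proof -
  define f where "f = (\<lambda>u. if u = x then x' else if u = y then y' else z')"
  have ne: "x \<noteq> y" "x \<noteq> z" "x' \<noteq> y'" "x' \<noteq> z'" using assms(1-4) adj_irr by auto
  have f: "f x = x'" "f y = y'" "f z = z'" using ne assms(9) by (auto simp: f_def)
  have conn: "uconnected_on {u, v, w} A" if "adj u v" "adj u w" for u v w
  proof -
    let ?R = "\<lambda>a b. a \<in> {u, v, w} \<and> b \<in> {u, v, w} \<and> adj a b"
    have 1: "?R\<^sup>*\<^sup>* a u" if "a \<in> {u, v, w}" for a
      using that \<open>adj u v\<close> \<open>adj u w\<close> adj_sym by (cases "a = u") auto
    have 2: "?R\<^sup>*\<^sup>* u a" if "a \<in> {u, v, w}" for a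
      using that \<open>adj u v\<close> \<open>adj u w\<close> by (cases "a = u") auto
    show ?thesis unfolding uconnected_on_def using 1 2 by (meson rtranclp_trans)
  qed
  have opp: "A y x \<longleftrightarrow> A y' x'" "A z x \<longleftrightarrow> A z' x'"
    using assms arc_anti unfolding uadj_def by blast+
  have "\<exists>g. automorphism V A g \<and> (\<forall>u\<in>{x, y, z}. g u = f u)"
  proof (rule hom[unfolded connected_homogeneous_def, rule_format, of "{x, y, z}" "{x', y', z'}" f], intro conjI ballI)
    show "{x, y, z} \<subseteq> V" "{x', y', z'} \<subseteq> V" using assms(1-4) adj_V by blast+
    show "bij_betw f {x, y, z} {x', y', z'}"
      unfolding bij_betw_def inj_on_def using f ne assms(9) by auto
    show "A u v \<longleftrightarrow> A (f u) (f v)" if "u \<in> {x, y, z}" "v \<in> {x, y, z}" for u v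
      using that f assms(5-8) opp arc_irr by auto
  qed (use conn assms(1-4) in auto)
  then show ?thesis using that f by auto
qed

lemma arc_transitive:
  assumes "A x y" "A x' y'"
  obtains g where "automorphism V A g" "g x = x'" "g y = y'"
  by (rule triple_transitive[of x y y x' y' y']) (use assms arc_irr in \<open>auto simp: uadj_def\<close>)

lemma aut_arc: "automorphism V A g \<Longrightarrow> x \<in> V \<Longrightarrow> y \<in> V \<Longrightarrow> A (g x) (g y) \<longleftrightarrow> A x y"
  by (auto simp: automorphism_def)

lemma aut_adj: "automorphism V A g \<Longrightarrow> x \<in> V \<Longrightarrow> y \<in> V \<Longrightarrow> adj (g x) (g y) \<longleftrightarrow> adj x y"
  by (auto simp: uadj_def aut_arc)

lemma aut_bij: "automorphism V A g \<Longrightarrow> bij_betw g V V"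
  by (auto simp: automorphism_def)

lemma aut_image_inj: "automorphism V A g \<Longrightarrow> inj_on ((`) g) (Pow V)"
  using aut_bij by (auto simp: bij_betw_def intro: inj_on_image_Pow)

text \<open>A tournament on three vertices has a directed path through all of them. At this stage
  the third edge may point either way.\<close>

lemma ex_path_in_triangle: "\<exists>u v t. A u v \<and> A v t \<and> adj u t"
proof -
  obtain x y z where "adj x y" "adj y z" "adj x z" using tri unfolding embeds_triangle_def by blast
  then show ?thesis unfolding uadj_def by blast
qed

text \<open>Lets an in-neighbour be traded for an out-neighbour inside a triangle: arc-transitivity
  moves the first arc of a path in a triangle to any given arc. The converse trade uses the second
  arc.\<close>

lemma in_nbr_has_adjacent_out_nbr:
  assumes "A q x" shows "\<exists>p. A x p \<and> adj q p"
proof -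
  obtain u v t where uvt: "A u v" "A v t" "adj u t" using ex_path_in_triangle by blast
  obtain g where g: "automorphism V A g" "g u = q" "g v = x" using arc_transitive[OF uvt(1) assms] .
  have "A x (g t)" "adj q (g t)"
    using aut_arc[OF g(1), of v t] aut_adj[OF g(1), of u t] uvt g arc_V by auto
  then show ?thesis by blast
qed

lemma out_nbr_has_adjacent_in_nbr:
  assumes "A x p" shows "\<exists>q. A q x \<and> adj q p"
proof -
  obtain u v t where uvt: "A u v" "A v t" "adj u t" using ex_path_in_triangle by blast
  obtain g where g: "automorphism V A g" "g v = x" "g t = p" using arc_transitive[OF uvt(2) assms] .
  have "A (g u) x" "adj (g u) p"
    using aut_arc[OF g(1), of u v] aut_adj[OF g(1), of u t] uvt g arc_V by auto
  then show ?thesis by blast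
qed

lemma adj_in_triangle:
  assumes "adj x y" shows "\<exists>z. adj x z \<and> adj y z"
  using assms in_nbr_has_adjacent_out_nbr out_nbr_has_adjacent_in_nbr adj_sym
  unfolding uadj_def by meson

lemma ex_out_nbr: "x \<in> V \<Longrightarrow> \<exists>y. A x y"
proof -
  assume x: "x \<in> V"
  obtain u v t where uvt: "A u v" "A v t" "adj u t" using ex_path_in_triangle by blast
  obtain g where g: "automorphism V A g" "g v = x" using vertex_transitive[of v x] x arc_V uvt by blast
  then have "A x (g t)" using aut_arc[OF g(1), of v t] uvt arc_V by auto
  then show ?thesis by blast
qed

text \<open>An orientation assigns to every vertex \<open>x\<close> a choice of one side of each cut, consistently and
  equivariantly; it encodes an equivariant map from \<open>V\<close> to the vertices of the structure tree of \<open>\<E>\<close>,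
  and \<open>\<sigma> x - \<sigma> y\<close> is the set of tree edges on the path from the image of \<open>x\<close> to that of \<open>y\<close>.\<close>

definition orientation :: "('a \<Rightarrow> 'a set set) \<Rightarrow> bool" where
  "orientation \<sigma> \<longleftrightarrow> (\<forall>x\<in>V. \<sigma> x \<subseteq> \<E>) \<and> (\<forall>x\<in>V. \<forall>e\<in>\<E>. V - e \<in> \<sigma> x \<longleftrightarrow> e \<notin> \<sigma> x) \<and>
     (\<forall>x\<in>V. \<forall>e\<in>\<sigma> x. \<forall>f\<in>\<E>. e \<subseteq> f \<longrightarrow> f \<in> \<sigma> x) \<and>
     (\<forall>x\<in>V. finite ({e \<in> \<E>. x \<in> e} - \<sigma> x)) \<and> (\<forall>x y. adj x y \<longrightarrow> finite (\<sigma> x - \<sigma> y)) \<and>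
     (\<forall>g x. automorphism V A g \<longrightarrow> x \<in> V \<longrightarrow> \<sigma> (g x) = (`) g ` \<sigma> x)"

lemma orientationD:
  assumes "orientation \<sigma>"
  shows "x \<in> V \<Longrightarrow> e \<in> \<sigma> x \<Longrightarrow> e \<in> \<E>"
    and "x \<in> V \<Longrightarrow> e \<in> \<E> \<Longrightarrow> V - e \<in> \<sigma> x \<longleftrightarrow> e \<notin> \<sigma> x"
    and "x \<in> V \<Longrightarrow> e \<in> \<sigma> x \<Longrightarrow> f \<in> \<E> \<Longrightarrow> e \<subseteq> f \<Longrightarrow> f \<in> \<sigma> x"
    and "x \<in> V \<Longrightarrow> finite ({e \<in> \<E>. x \<in> e} - \<sigma> x)"
    and "adj x y \<Longrightarrow> finite (\<sigma> x - \<sigma> y)"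
    and "automorphism V A g \<Longrightarrow> x \<in> V \<Longrightarrow> \<sigma> (g x) = (`) g ` \<sigma> x"
proof -
  note 1 = assms[unfolded orientation_def]
  note 2 = conjunct2[OF 1] note 3 = conjunct2[OF 2] note 4 = conjunct2[OF 3] note 5 = conjunct2[OF 4]
  show "x \<in> V \<Longrightarrow> e \<in> \<sigma> x \<Longrightarrow> e \<in> \<E>" using conjunct1[OF 1] by blast
  show "x \<in> V \<Longrightarrow> e \<in> \<E> \<Longrightarrow> V - e \<in> \<sigma> x \<longleftrightarrow> e \<notin> \<sigma> x" using conjunct1[OF 2] by blast
  show "x \<in> V \<Longrightarrow> e \<in> \<sigma> x \<Longrightarrow> f \<in> \<E> \<Longrightarrow> e \<subseteq> f \<Longrightarrow> f \<in> \<sigma> x" using conjunct1[OF 3] by simp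
  show "x \<in> V \<Longrightarrow> finite ({e \<in> \<E>. x \<in> e} - \<sigma> x)" using conjunct1[OF 4] by simp
  show "adj x y \<Longrightarrow> finite (\<sigma> x - \<sigma> y)" using conjunct1[OF 5] by simp
  show "automorphism V A g \<Longrightarrow> x \<in> V \<Longrightarrow> \<sigma> (g x) = (`) g ` \<sigma> x" using conjunct2[OF 5] by simp
qed

text \<open>The initial map to the structure tree, from which the descent on the length
  starts.\<close>

lemma orientation_membership: "orientation (\<lambda>x. {e \<in> \<E>. x \<in> e})"
  unfolding orientation_def
proof (intro conjI ballI allI impI)
  fix x y assume "adj x y"
  then have "finite {e \<in> \<E>. x \<in> e \<and> y \<notin> e}" using fin_sep adj_V by blast
  then show "finite ({e \<in> \<E>. x \<in> e} - {e \<in> \<E>. y \<in> e})" by (rule rev_finite_subset) auto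
next
  fix g x assume g: "automorphism V A g" and x: "x \<in> V"
  have inj: "inj_on g V" and im: "g ` V = V" using aut_bij[OF g] by (auto simp: bij_betw_def)
  show "{e \<in> \<E>. g x \<in> e} = (`) g ` {e \<in> \<E>. x \<in> e}"
  proof
    show "(`) g ` {e \<in> \<E>. x \<in> e} \<subseteq> {e \<in> \<E>. g x \<in> e}" using aut_inv[OF g] by auto
    show "{e \<in> \<E>. g x \<in> e} \<subseteq> (`) g ` {e \<in> \<E>. x \<in> e}"
    proof
      fix e assume e: "e \<in> {e \<in> \<E>. g x \<in> e}"
      let ?h = "inv_into V g"
      have "automorphism V A ?h" unfolding automorphism_def
      proof (intro conjI ballI)
        show b: "bij_betw ?h V V" using aut_bij[OF g] by (rule bij_betw_inv_into)
        show "A u v \<longleftrightarrow> A (?h u) (?h v)" if "u \<in> V" "v \<in> V" for u v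
          using aut_arc[OF g, of "?h u" "?h v"] that im by (simp add: f_inv_into_f inv_into_into)
      qed
      then have "?h ` e \<in> \<E>" using aut_inv e by blast
      moreover have "e \<subseteq> V" using e cut by blast
      then have "g ` (?h ` e) = e" using im by (simp add: image_inv_into_cancel)
      moreover have "x \<in> ?h ` e" using e inv_into_f_f[OF inj x] by (metis (mono_tags) image_eqI mem_Collect_eq)
      ultimately show "e \<in> (`) g ` {e \<in> \<E>. x \<in> e}" by (metis (mono_tags, lifting) image_eqI mem_Collect_eq)
    qed
  qed
qed (use compl in \<open>auto simp: cut\<close>)

text \<open>If all neighbours had the same orientation, the innermost cuts pointing away from this common
  value would partition \<open>V\<close> into infinite classes, each either a union of components of the graph or
  without inner edges.\<close>

lemma orientation_not_constant:
  assumes \<sigma>: "orientation \<sigma>" and const: "\<And>x y. adj x y \<Longrightarrow> \<sigma> x = \<sigma> y"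
  shows False
proof -
  note D = orientationD[OF \<sigma>]
  \<comment> \<open>In the tree, these are the edges between the common value and the place of
    \<open>x\<close>.\<close>
  define H where "H x = {e \<in> \<E>. x \<in> e} - \<sigma> x" for x
  have cst: "\<sigma> x = \<sigma> y" if "x \<in> V" "y \<in> V" for x y using adj_invariant_const[of \<sigma>, OF const that] .
  have Hg: "H (g x) = (`) g ` H x" if g: "automorphism V A g" and x: "x \<in> V" for g x
  proof -
    have "H (g x) = (`) g ` {e \<in> \<E>. x \<in> e} - (`) g ` \<sigma> x"
      using orientationD(6)[OF orientation_membership g x] D(6)[OF g x] by (simp add: H_def)
    also have "\<dots> = (`) g ` H x" unfolding H_def
      by (rule inj_on_image_set_diff[symmetric, OF aut_image_inj[OF g]]) (use cut D(1)[OF x] in blast)+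
    finally show ?thesis .
  qed
  have finH: "finite (H x)" if "x \<in> V" for x using D(4)[OF that] by (simp add: H_def)
  have cardH: "card (H y) = card (H x)" if "x \<in> V" "y \<in> V" for x y
  proof -
    obtain g where g: "automorphism V A g" "g x = y" using vertex_transitive \<open>x \<in> V\<close> \<open>y \<in> V\<close> by blast
    have "H x \<subseteq> Pow V" using cut by (auto simp: H_def)
    then show ?thesis using Hg[OF g(1) that(1)] g(2) aut_image_inj[OF g(1)]
      by (metis card_image inj_on_subset)
  qed
  obtain v0 where v0: "v0 \<in> V" using con by (auto simp: connected_digraph_def)
  obtain f where f: "f \<in> \<E>" "f \<notin> \<sigma> v0" using ne compl D(2)[OF v0] by blast
  obtain x where x: "x \<in> f" "x \<in> V" using cut[OF f(1)] by (metis finite.emptyI ex_in_conv subsetD)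
  have "f \<in> H x" using f x cst[OF v0 x(2)] by (auto simp: H_def)
  then obtain h where h: "h \<in> H x" and hmin: "\<And>e. e \<in> H x \<Longrightarrow> e \<subseteq> h \<Longrightarrow> e = h"
    using finite_has_minimal[OF finH[OF x(2)]] by (metis empty_iff)
  have hE: "h \<in> \<E>" "x \<in> h" "h \<notin> \<sigma> x" using h by (auto simp: H_def)
  have least: "h \<subseteq> e" if e: "e \<in> H x" for e
  proof -
    have e': "e \<in> \<E>" "x \<in> e" "e \<notin> \<sigma> x" using e by (auto simp: H_def)
    have "\<not> V \<subseteq> e \<union> h"
    proof
      assume "V \<subseteq> e \<union> h"
      then have "V - e \<subseteq> h" by blast
      moreover have "V - e \<in> \<sigma> x" using D(2)[OF x(2) e'(1)] e' by blast
      ultimately show False using D(3)[OF x(2)] hE by blast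
    qed
    then have "e \<subseteq> h \<or> h \<subseteq> e" using nest[OF e'(1) hE(1)] e' hE by blast
    then show ?thesis using hmin[OF e] by blast
  qed
  have hc: "h \<subseteq> V" "infinite h" "infinite (V - h)" "finite (edge_bd adj h)" using cut[OF hE(1)] by auto
  \<comment> \<open>\<open>H y\<close> contains \<open>H x\<close> because \<open>h\<close> is least
    in \<open>H x\<close>, and by vertex-transitivity both have equally many members.\<close>
  have eq: "H y = H x" if y: "y \<in> h" for y
  proof -
    have yV: "y \<in> V" using y hc by blast
    have "H x \<subseteq> H y" using least y cst[OF x(2) yV] by (auto simp: H_def)
    then show ?thesis using card_subset_eq[OF finH[OF yV]] cardH[OF yV x(2)] by metis
  qed
  \<comment> \<open>One edge inside \<open>h\<close> gives an arc with the same \<open>H\<close> at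
    both ends; by arc-transitivity all arcs have this property, and connectedness would put all of
    \<open>V\<close> into \<open>h\<close>.\<close>
  have no: "z \<notin> h" if y: "y \<in> h" "adj y z" for y z
  proof
    assume z: "z \<in> h"
    have Hyz: "H y = H z" using eq y z by simp
    have arcs: "H u = H v" if uv: "A u v" for u v
    proof -
      obtain a b where ab: "A a b" "H a = H b" using y(2) Hyz by (auto simp: uadj_def)
      obtain g where g: "automorphism V A g" "g a = u" "g b = v" using arc_transitive[OF ab(1) uv] .
      show ?thesis using Hg[OF g(1), of a] Hg[OF g(1), of b] ab arc_V[OF ab(1)] g by simp
    qed
    have "H u = H v" if "adj u v" for u v using that arcs[of u v] arcs[of v u] by (auto simp: uadj_def)
    then have "H v = H x" if "v \<in> V" for v using adj_invariant_const[of H v x] that x by blast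
    then have "V \<subseteq> h" using h by (auto simp: H_def)
    then show False using hc(3) by (metis Diff_eq_empty_iff finite.emptyI)
  qed
  \<comment> \<open>Every edge at a vertex of \<open>h\<close> now leaves \<open>h\<close>, so the
    finite boundary bounds the infinite set \<open>h\<close>.\<close>
  have "h \<subseteq> fst ` edge_bd adj h"
  proof
    fix y assume y: "y \<in> h"
    then obtain z where "adj y z" using ex_out_nbr hc by (metis subsetD uadj_def)
    then have "(y, z) \<in> edge_bd adj h" using y no by (auto simp: edge_bd_def)
    then show "y \<in> fst ` edge_bd adj h" by force
  qed
  then show False using hc by (meson finite_imageI finite_subset)
qed

text \<open>The edges of a tree path are linearly ordered: disjoint sides cannot both be chosen at
  \<open>x\<close>, and sides covering \<open>V\<close> cannot both be rejected at
  \<open>y\<close>.\<close>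

lemma orientation_diff_chain:
  assumes \<sigma>: "orientation \<sigma>" and V: "x \<in> V" "y \<in> V" and e: "e \<in> \<sigma> x - \<sigma> y" and f: "f \<in> \<sigma> x - \<sigma> y"
  shows "e \<subseteq> f \<or> f \<subseteq> e"
proof -
  note D = orientationD[OF \<sigma>]
  have E: "e \<in> \<E>" "f \<in> \<E>" using e f D(1)[OF V(1)] by auto
  have "e \<inter> f \<noteq> {}"
  proof
    assume "e \<inter> f = {}"
    then have "e \<subseteq> V - f" using cut[OF E(1)] by blast
    then show False using D(3)[OF V(1), of e "V - f"] D(2)[OF V(1) E(2)] compl E e f by blast
  qed
  moreover have "\<not> V \<subseteq> e \<union> f"
  proof
    assume "V \<subseteq> e \<union> f"
    then have "V - e \<subseteq> f" by blast
    then show False using D(3)[OF V(2), of "V - e" f] D(2)[OF V(2) E(1)] E e f by blast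
  qed
  ultimately show ?thesis using nest[OF E] by blast
qed

lemma orientation_diff_compl:
  assumes \<sigma>: "orientation \<sigma>" and V: "x \<in> V" "y \<in> V"
  shows "(-) V ` (\<sigma> x - \<sigma> y) = \<sigma> y - \<sigma> x"
proof -
  note D = orientationD[OF \<sigma>]
  have 1: "(-) V ` (\<sigma> x - \<sigma> y) \<subseteq> \<sigma> y - \<sigma> x" if "x \<in> V" "y \<in> V" for x y
    using D(1)[OF that(1)] D(2)[OF that(1)] D(2)[OF that(2)] by auto
  show ?thesis
  proof
    show "\<sigma> y - \<sigma> x \<subseteq> (-) V ` (\<sigma> x - \<sigma> y)"
    proof
      fix e assume e: "e \<in> \<sigma> y - \<sigma> x"
      then have "V - e \<in> \<sigma> x - \<sigma> y" using 1[OF V(2,1)] by blast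
      moreover have "V - (V - e) = e" using cut[OF D(1)[OF V(2)]] e by blast
      ultimately show "e \<in> (-) V ` (\<sigma> x - \<sigma> y)" by (metis image_eqI)
    qed
  qed (rule 1[OF V])
qed

lemma card_orientation_diff_sym:
  assumes \<sigma>: "orientation \<sigma>" and V: "x \<in> V" "y \<in> V"
  shows "card (\<sigma> y - \<sigma> x) = card (\<sigma> x - \<sigma> y)"
proof -
  have "inj_on ((-) V) (\<sigma> x - \<sigma> y)"
    using cut orientationD(1)[OF \<sigma> V(1)] by (intro inj_onI) (metis Diff_iff double_diff subset_refl)
  then show ?thesis using card_image orientation_diff_compl[OF assms] by metis
qed

lemma orientation_diff_aut:
  assumes \<sigma>: "orientation \<sigma>" and g: "automorphism V A g" and V: "x \<in> V" "y \<in> V"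
  shows "\<sigma> (g x) - \<sigma> (g y) = (`) g ` (\<sigma> x - \<sigma> y)"
proof -
  have "(`) g ` (\<sigma> x - \<sigma> y) = (`) g ` \<sigma> x - (`) g ` \<sigma> y"
    by (rule inj_on_image_set_diff[OF aut_image_inj[OF g]])
      (use cut orientationD(1)[OF \<sigma> V(1)] orientationD(1)[OF \<sigma> V(2)] in blast)+
  then show ?thesis using orientationD(6)[OF \<sigma> g] V by simp
qed

text \<open>Arc-transitivity gives one length for all arcs, and reversing a tree path, which
  complements its cuts, preserves the length.\<close>

lemma orientation_diff_card_const:
  assumes \<sigma>: "orientation \<sigma>"
  shows "\<exists>n. \<forall>x y. adj x y \<longrightarrow> card (\<sigma> x - \<sigma> y) = n"
proof -
  obtain u v t where uv: "A u v" using ex_path_in_triangle by blast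
  have arc: "card (\<sigma> x - \<sigma> y) = card (\<sigma> u - \<sigma> v)" if xy: "A x y" for x y
  proof -
    obtain g where g: "automorphism V A g" "g u = x" "g v = y" using arc_transitive[OF uv xy] .
    have "inj_on ((`) g) (\<sigma> u - \<sigma> v)"
      by (rule inj_on_subset[OF aut_image_inj[OF g(1)]])
        (use cut orientationD(1)[OF \<sigma>, of u] arc_V[OF uv] in blast)
    then show ?thesis using orientation_diff_aut[OF \<sigma> g(1), of u v] arc_V[OF uv] g by (simp add: card_image)
  qed
  then have "card (\<sigma> x - \<sigma> y) = card (\<sigma> u - \<sigma> v)" if "adj x y" for x y
    using that card_orientation_diff_sym[OF \<sigma>, of x y] arc_V[of x y] arc_V[of y x]
    unfolding uadj_def by metis
  then show ?thesis by blast
qed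

text \<open>The first edge of the tree path from \<open>x\<close> to \<open>y\<close>: the sides
  chosen at \<open>x\<close> grow along the path, so the first is the smallest.\<close>

definition first_cut :: "('a \<Rightarrow> 'a set set) \<Rightarrow> 'a \<Rightarrow> 'a \<Rightarrow> 'a set" where
  "first_cut \<sigma> x y = (THE e. e \<in> \<sigma> x - \<sigma> y \<and> (\<forall>f\<in>\<sigma> x - \<sigma> y. e \<subseteq> f))"

lemma first_cut_eqI:
  "e \<in> \<sigma> x - \<sigma> y \<Longrightarrow> (\<And>f. f \<in> \<sigma> x - \<sigma> y \<Longrightarrow> e \<subseteq> f) \<Longrightarrow> first_cut \<sigma> x y = e"
  unfolding first_cut_def by (rule the_equality) blast+

end

section \<open>First edges and the descent to a reduced map\<close>

locale separating_orientation = homogeneous_cut_system +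
  fixes \<sigma> :: "'a \<Rightarrow> 'a set set" and n :: nat
  assumes \<sigma>: "orientation \<sigma>" and len: "adj x y \<Longrightarrow> card (\<sigma> x - \<sigma> y) = n" and n0: "n > 0"
begin

lemmas \<sigma>D = orientationD[OF \<sigma>]

abbreviation fc where "fc \<equiv> first_cut \<sigma>"

lemma fc:
  assumes xy: "adj x y"
  shows "fc x y \<in> \<sigma> x" "fc x y \<notin> \<sigma> y" "\<And>f. f \<in> \<sigma> x - \<sigma> y \<Longrightarrow> fc x y \<subseteq> f"
proof -
  have V: "x \<in> V" "y \<in> V" using adj_V xy by auto
  have "\<sigma> x - \<sigma> y \<noteq> {}" using len[OF xy] n0 by (metis card.empty less_irrefl)
  then obtain e where e: "e \<in> \<sigma> x - \<sigma> y" and min: "\<And>f. f \<in> \<sigma> x - \<sigma> y \<Longrightarrow> f \<subseteq> e \<Longrightarrow> f = e"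
    using finite_has_minimal[OF \<sigma>D(5)[OF xy]] by blast
  have least: "e \<subseteq> f" if "f \<in> \<sigma> x - \<sigma> y" for f
    using orientation_diff_chain[OF \<sigma> V e that] min[OF that] by blast
  have "fc x y = e" using e least by (rule first_cut_eqI)
  then show "fc x y \<in> \<sigma> x" "fc x y \<notin> \<sigma> y" "\<And>f. f \<in> \<sigma> x - \<sigma> y \<Longrightarrow> fc x y \<subseteq> f" using e least by auto
qed

text \<open>The first edge is incident with the image of \<open>x\<close>: the edges at a tree
  vertex are the minimal members of its orientation.\<close>

lemma fc_minimal:
  assumes xy: "adj x y" and e: "e \<in> \<sigma> x" "e \<subseteq> fc x y"
  shows "e = fc x y"
proof -
  have V: "x \<in> V" "y \<in> V" using adj_V xy by auto
  have "e \<notin> \<sigma> y"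
    using \<sigma>D(3)[OF V(2) _ \<sigma>D(1)[OF V(1) fc(1)[OF xy]] e(2)] fc(2)[OF xy] by auto
  then show ?thesis using fc(3)[OF xy, of e] e by auto
qed

lemma fc_opposite:
  assumes xy: "adj x y"
  shows "fc y x \<subseteq> V - fc x y"
proof -
  have V: "x \<in> V" "y \<in> V" using adj_V xy by auto
  have "V - fc x y \<in> \<sigma> y - \<sigma> x" using orientation_diff_compl[OF \<sigma> V] fc(1,2)[OF xy] by blast
  then show ?thesis by (rule fc(3)[OF adj_sym[OF xy]])
qed

lemma fc_aut:
  assumes g: "automorphism V A g" and xy: "adj x y"
  shows "fc (g x) (g y) = g ` fc x y"
proof -
  have V: "x \<in> V" "y \<in> V" using adj_V xy by auto
  show ?thesis
  proof (rule first_cut_eqI)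
    show "g ` fc x y \<in> \<sigma> (g x) - \<sigma> (g y)"
      unfolding orientation_diff_aut[OF \<sigma> g V] using fc(1,2)[OF xy] by blast
    fix f assume "f \<in> \<sigma> (g x) - \<sigma> (g y)"
    then obtain e where e: "e \<in> \<sigma> x - \<sigma> y" "f = g ` e"
      unfolding orientation_diff_aut[OF \<sigma> g V] by blast
    show "g ` fc x y \<subseteq> f" unfolding e(2) by (rule image_mono[OF fc(3)[OF xy e(1)]])
  qed
qed

text \<open>If the two paths from \<open>x\<close> started with different edges, they would share
  none, and the path from \<open>z\<close> through \<open>x\<close> to \<open>y\<close> would have
  length \<open>2 * n\<close> instead of \<open>n\<close>.\<close>

lemma fc_triangle:
  assumes xy: "adj x y" and xz: "adj x z" and yz: "adj y z"
  shows "fc x y = fc x z"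
proof (rule ccontr)
  assume ne: "fc x y \<noteq> fc x z"
  have V: "x \<in> V" "y \<in> V" "z \<in> V" using adj_V xy yz by auto
  \<comment> \<open>A cut on both paths would contain both first cuts; this puts each of them on
    both paths and makes them equal.\<close>
  have disj: "(\<sigma> x - \<sigma> y) \<inter> (\<sigma> x - \<sigma> z) = {}"
  proof (rule ccontr)
    assume "\<not> ?thesis"
    then obtain g where g: "g \<in> \<sigma> x" "g \<notin> \<sigma> y" "g \<notin> \<sigma> z" by blast
    have gE: "g \<in> \<E>" using g \<sigma>D(1)[OF V(1)] by blast
    have "fc x y \<subseteq> g" "fc x z \<subseteq> g" using fc(3)[OF xy] fc(3)[OF xz] g by auto
    then have "fc x y \<notin> \<sigma> z" "fc x z \<notin> \<sigma> y"
      using \<sigma>D(3)[OF V(3) _ gE] \<sigma>D(3)[OF V(2) _ gE] g by auto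
    then have "fc x z \<subseteq> fc x y" "fc x y \<subseteq> fc x z"
      using fc(1)[OF xy] fc(1)[OF xz] fc(3)[OF xy, of "fc x z"] fc(3)[OF xz, of "fc x y"]
        fc(3)[OF xz, of "fc x z"] by auto
    then show False using ne by blast
  qed
  have 1: "\<sigma> x - \<sigma> y \<subseteq> \<sigma> z - \<sigma> y" using disj by blast
  have 2: "\<sigma> z - \<sigma> x \<subseteq> \<sigma> z - \<sigma> y"
  proof
    fix e assume e: "e \<in> \<sigma> z - \<sigma> x"
    then obtain f where f: "f \<in> \<sigma> x - \<sigma> z" "e = V - f" using orientation_diff_compl[OF \<sigma> V(1,3)] by blast
    then have "f \<in> \<sigma> y" using disj by blast
    moreover have "f \<in> \<E>" using f \<sigma>D(1)[OF V(1)] by blast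
    ultimately show "e \<in> \<sigma> z - \<sigma> y" using e f \<sigma>D(2)[OF V(2)] by auto
  qed
  have fin: "finite (\<sigma> x - \<sigma> y)" "finite (\<sigma> z - \<sigma> x)" "finite (\<sigma> z - \<sigma> y)"
    using \<sigma>D(5) xy xz yz adj_sym by blast+
  have "card ((\<sigma> x - \<sigma> y) \<union> (\<sigma> z - \<sigma> x)) = n + n"
    using len[OF xy] len[OF adj_sym[OF xz]] fin by (subst card_Un_disjoint) auto
  moreover have "card ((\<sigma> x - \<sigma> y) \<union> (\<sigma> z - \<sigma> x)) \<le> n"
    using card_mono[OF fin(3), of "(\<sigma> x - \<sigma> y) \<union> (\<sigma> z - \<sigma> x)"] 1 2 len[OF adj_sym[OF yz]] by simp
  ultimately show False using n0 by simp
qed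

text \<open>Nonadjacent pairs of neighbours with prescribed directions are all equivalent under
  automorphisms, so one bad pair makes every pair with its directions agree on the first edge;
  adjacent pairs agree anyway. Any \<open>v\<close> and \<open>w\<close> reduce to such a pair,
  since triangles allow each to be replaced by an in- or out-neighbour with the same first
  edge.\<close>

lemma fc_dichotomy:
  assumes bad: "adj x y" "adj x z" "fc x y = fc x z" "y \<noteq> z" "\<not> adj y z"
    and uv: "adj u v" and uw: "adj u w"
  shows "fc u v = fc u w"
proof -
  have same: "fc u p = fc u q" if pq: "adj u p" "adj u q" "A x y \<longleftrightarrow> A u p" "A x z \<longleftrightarrow> A u q" for p q
  proof (cases "p = q \<or> adj p q")
    case True
    then show ?thesis using fc_triangle pq by blast
  next
    case False
    then obtain g where g: "automorphism V A g" "g x = u" "g y = p" "g z = q"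
      using triple_transitive[OF bad(1,2) pq] bad unfolding uadj_def by metis
    show ?thesis using fc_aut[OF g(1)] bad g by metis
  qed
  have out: "\<exists>p. A u p \<and> fc u v = fc u p" if "adj u v" for v
  proof (cases "A u v")
    case False
    then have "A v u" using that by (simp add: uadj_def)
    then obtain p where "A u p" "adj v p" using in_nbr_has_adjacent_out_nbr by blast
    then show ?thesis using fc_triangle[of u v p] that by (auto simp: uadj_def)
  qed auto
  have inn: "\<exists>p. A p u \<and> fc u v = fc u p" if "adj u v" for v
  proof (cases "A v u")
    case False
    then have "A u v" using that by (simp add: uadj_def)
    then obtain p where "A p u" "adj p v" using out_nbr_has_adjacent_in_nbr by blast
    then show ?thesis using fc_triangle[of u v p] that by (auto simp: uadj_def)
  qed auto
  obtain p p' q q' where p: "A u p" "fc u v = fc u p" "A u p'" "fc u w = fc u p'"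
    and q: "A q u" "fc u v = fc u q" "A q' u" "fc u w = fc u q'"
    using out[OF uv] out[OF uw] inn[OF uv] inn[OF uw] by blast
  have adj: "adj u p" "adj u p'" "adj u q" "adj u q'" "\<not> A u q" "\<not> A u q'"
    using p q arc_anti by (auto simp: uadj_def)
  consider "A x y" "A x z" | "A x y" "\<not> A x z" | "\<not> A x y" "A x z" | "\<not> A x y" "\<not> A x z" by blast
  then show ?thesis
  proof cases
    case 1
    then show ?thesis using same[of p p'] p adj by simp
  next
    case 2
    then show ?thesis using same[of p q'] p q adj by simp
  next
    case 3
    then show ?thesis using same[of q p'] p q adj by simp
  next
    case 4
    then show ?thesis using same[of q q'] q adj by simp
  qed
qed

text \<open>In the structure tree: if all paths from (the image of) \<open>x\<close> to its neighbours start with the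
  same edge, move \<open>x\<close> across that edge.\<close>

lemma shorten_orientation:
  assumes all: "\<And>x y z. adj x y \<Longrightarrow> adj x z \<Longrightarrow> fc x y = fc x z"
  shows "\<exists>\<tau>. orientation \<tau> \<and> (\<forall>x y. adj x y \<longrightarrow> card (\<tau> x - \<tau> y) < n)"
proof -
  define \<epsilon> where "\<epsilon> x = fc x (SOME y. adj x y)" for x
  have eps: "\<epsilon> x = fc x y" if "adj x y" for x y
    unfolding \<epsilon>_def using all[OF someI[of "adj x", OF that] that] .
  have ex: "\<exists>y. adj x y" if "x \<in> V" for x using ex_out_nbr[OF that] by (auto simp: uadj_def)
  have eps_in: "\<epsilon> x \<in> \<sigma> x" if "x \<in> V" for x using ex[OF that] fc(1) eps by metis
  have epsE: "\<epsilon> x \<in> \<E>" if "x \<in> V" for x using eps_in[OF that] \<sigma>D(1)[OF that] by blast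
  have eps_min: "e = \<epsilon> x" if "x \<in> V" "e \<in> \<sigma> x" "e \<subseteq> \<epsilon> x" for x e
    using ex[OF that(1)] fc_minimal eps that by metis
  have eps_notin: "\<epsilon> x \<notin> \<sigma> y" if "adj x y" for x y using fc(2)[OF that] eps[OF that] by simp
  have dd: "V - (V - e) = e" if "e \<in> \<E>" for e using cut[OF that] by blast
  have neV: "V - e \<noteq> e" if "e \<in> \<E>" for e
    using cut[OF that] by (metis Diff_disjoint Int_absorb finite.emptyI)
  define \<tau> where "\<tau> x = insert (V - \<epsilon> x) (\<sigma> x - {\<epsilon> x})" for x
  have "orientation \<tau>"
    unfolding orientation_def
  proof (intro conjI ballI allI impI)
    fix x assume x: "x \<in> V"
    show "\<tau> x \<subseteq> \<E>" using \<sigma>D(1)[OF x] compl epsE[OF x] by (auto simp: \<tau>_def)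
    show "V - e \<in> \<tau> x \<longleftrightarrow> e \<notin> \<tau> x" if e: "e \<in> \<E>" for e
    proof (cases "e = \<epsilon> x \<or> e = V - \<epsilon> x")
      case True
      then show ?thesis using neV[OF epsE[OF x]] dd[OF epsE[OF x]] by (auto simp: \<tau>_def)
    next
      case False
      then have "V - e \<noteq> \<epsilon> x" "V - e \<noteq> V - \<epsilon> x" using dd[OF e] dd[OF epsE[OF x]] by metis+
      then show ?thesis using False \<sigma>D(2)[OF x e] by (auto simp: \<tau>_def)
    qed
    \<comment> \<open>Closure under supersets survives the flip because \<open>\<epsilon> x\<close>
      is minimal in \<open>\<sigma> x\<close>.\<close>
    show "f \<in> \<tau> x" if e: "e \<in> \<tau> x" and f: "f \<in> \<E>" "e \<subseteq> f" for e f
    proof (cases "e = V - \<epsilon> x")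
      case False
      then have "e \<in> \<sigma> x" "e \<noteq> \<epsilon> x" using e by (auto simp: \<tau>_def)
      then show ?thesis using \<sigma>D(3)[OF x _ f] eps_min[OF x, of e] f by (auto simp: \<tau>_def)
    next
      case True
      have sub: "V - f \<subseteq> \<epsilon> x" using True f by blast
      have "f \<noteq> \<epsilon> x"
      proof
        assume "f = \<epsilon> x"
        then have "V - \<epsilon> x = {}" using True f by blast
        then show False using cut[OF epsE[OF x]] by (metis finite.emptyI)
      qed
      moreover have "f = V - \<epsilon> x" if "f \<notin> \<sigma> x"
      proof -
        have "V - f = \<epsilon> x" using \<sigma>D(2)[OF x f(1)] that eps_min[OF x _ sub] by blast
        then show ?thesis using dd[OF f(1)] by simp
      qed
      ultimately show ?thesis by (auto simp: \<tau>_def)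
    qed
    have "{e \<in> \<E>. x \<in> e} - \<tau> x \<subseteq> insert (\<epsilon> x) ({e \<in> \<E>. x \<in> e} - \<sigma> x)" by (auto simp: \<tau>_def)
    then show "finite ({e \<in> \<E>. x \<in> e} - \<tau> x)" using \<sigma>D(4)[OF x] by (meson finite_insert finite_subset)
  next
    fix x y assume xy: "adj x y"
    have "\<tau> x - \<tau> y \<subseteq> insert (V - \<epsilon> x) (insert (\<epsilon> y) (\<sigma> x - \<sigma> y))" by (auto simp: \<tau>_def)
    then show "finite (\<tau> x - \<tau> y)" using \<sigma>D(5)[OF xy] by (meson finite_insert finite_subset)
  next
    fix g x assume g: "automorphism V A g" and x: "x \<in> V"
    obtain y where y: "adj x y" using ex[OF x] by blast
    have "adj (g x) (g y)" using aut_adj[OF g] adj_V[OF y] y by blast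
    then have eg: "\<epsilon> (g x) = g ` \<epsilon> x" using fc_aut[OF g y] eps y by metis
    have inj: "inj_on g V" and im: "g ` V = V" using aut_bij[OF g] by (auto simp: bij_betw_def)
    have "\<epsilon> x \<subseteq> V" using cut epsE[OF x] by blast
    then have 1: "V - \<epsilon> (g x) = g ` (V - \<epsilon> x)"
      unfolding eg using inj_on_image_set_diff[OF inj, of V "\<epsilon> x"] im by simp
    have sp: "\<sigma> x \<subseteq> Pow V" using cut \<sigma>D(1)[OF x] by blast
    have "(`) g ` (\<sigma> x - {\<epsilon> x}) = (`) g ` \<sigma> x - (`) g ` {\<epsilon> x}"
      by (rule inj_on_image_set_diff[OF aut_image_inj[OF g]]) (use sp \<open>\<epsilon> x \<subseteq> V\<close> in auto)
    then show "\<tau> (g x) = (`) g ` \<tau> x"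
      using 1 \<sigma>D(6)[OF g x] by (simp add: \<tau>_def eg)
  qed
  moreover have "card (\<tau> x - \<tau> y) < n" if xy: "adj x y" for x y
  proof -
    have V: "x \<in> V" "y \<in> V" using adj_V[OF xy] by auto
    \<comment> \<open>The third vertex of a triangle shows that \<open>x\<close> and
      \<open>y\<close> do not cross one edge in opposite directions: it rejects both
      \<open>\<epsilon> x\<close> and \<open>\<epsilon> y\<close>, but has to choose one of a cut
      and its complement.\<close>
    obtain z where z: "adj x z" "adj y z" using adj_in_triangle[OF xy] by blast
    have zV: "z \<in> V" using adj_V z by blast
    have ne: "V - \<epsilon> x \<noteq> \<epsilon> y"
      using eps_notin[OF z(1)] eps_notin[OF z(2)] \<sigma>D(2)[OF zV epsE[OF V(1)]] by metis
    have "V - \<epsilon> x \<in> \<sigma> y" using eps_notin[OF xy] \<sigma>D(2)[OF V(2) epsE[OF V(1)]] by blast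
    then have "\<tau> x - \<tau> y \<subseteq> (\<sigma> x - \<sigma> y) - {\<epsilon> x}"
      using ne eps_notin[OF adj_sym[OF xy]] by (auto simp: \<tau>_def)
    moreover have "\<epsilon> x \<in> \<sigma> x - \<sigma> y" using eps_in[OF V(1)] eps_notin[OF xy] by blast
    ultimately have "\<tau> x - \<tau> y \<subset> \<sigma> x - \<sigma> y" by blast
    then show ?thesis using psubset_card_mono[OF \<sigma>D(5)[OF xy]] len[OF xy] by simp
  qed
  ultimately show ?thesis by blast
qed

end

locale reduced_orientation = separating_orientation +
  assumes fc_eq_adj: "adj x y \<Longrightarrow> adj x z \<Longrightarrow> fc x y = fc x z \<Longrightarrow> y = z \<or> adj y z"

context homogeneous_cut_system
begin

text \<open>Descent on the common length. Length 0 would make the map constant along edges;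
  otherwise the dichotomy leaves the desired property or a strictly shorter map, whose length is
  again the same on all edges by arc-transitivity.\<close>

lemma ex_reduced_orientation: "\<exists>\<sigma> n. reduced_orientation V A \<E> \<sigma> n"
proof -
  have "\<exists>\<sigma> n. reduced_orientation V A \<E> \<sigma> n"
    if "orientation \<sigma>" "\<And>x y. adj x y \<Longrightarrow> card (\<sigma> x - \<sigma> y) = n" for \<sigma> n
    using that
  proof (induction n arbitrary: \<sigma> rule: less_induct)
    case (less n)
    show ?case
    proof (cases "n = 0")
      case True
      have "\<sigma> x = \<sigma> y" if xy: "adj x y" for x y
        using less.prems(2)[OF xy] less.prems(2)[OF adj_sym[OF xy]] True
          orientationD(5)[OF less.prems(1) xy] orientationD(5)[OF less.prems(1) adj_sym[OF xy]] by auto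
      then show ?thesis using orientation_not_constant[OF less.prems(1)] by blast
    next
      case False
      interpret separating_orientation V A \<E> \<sigma> n
        by unfold_locales (use less.prems False in simp_all)
      show ?thesis
      proof (cases "\<forall>x y z. adj x y \<longrightarrow> adj x z \<longrightarrow> fc x y = fc x z \<longrightarrow> y = z \<or> adj y z")
        case True
        then have "reduced_orientation V A \<E> \<sigma> n" by unfold_locales blast
        then show ?thesis by blast
      next
        case False
        then have "fc x y = fc x z" if "adj x y" "adj x z" for x y z using fc_dichotomy that by blast
        then obtain \<tau> where \<tau>: "orientation \<tau>" "\<And>x y. adj x y \<Longrightarrow> card (\<tau> x - \<tau> y) < n"
          using shorten_orientation by blast
        obtain m where m: "\<And>x y. adj x y \<Longrightarrow> card (\<tau> x - \<tau> y) = m"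
          using orientation_diff_card_const[OF \<tau>(1)] by blast
        obtain u v where "A u v" using ex_path_in_triangle by blast
        then have "m < n" using \<tau>(2)[of u v] m[of u v] by (simp add: uadj_def)
        then show ?thesis using less.IH \<tau>(1) m by blast
      qed
    qed
  qed
  then show ?thesis using orientation_membership orientation_diff_card_const[OF orientation_membership] by blast
qed

end

section \<open>Reduced walks and the separation of neighbours\<close>

context reduced_orientation
begin

lemma fc_eq_iff: "adj x y \<Longrightarrow> adj x z \<Longrightarrow> fc x y = fc x z \<longleftrightarrow> y = z \<or> adj y z"
  using fc_eq_adj fc_triangle by blast

text \<open>Inside a neighbourhood, being equal or adjacent means having the same first edge; so the
  neighbourhood is a disjoint union of cliques.\<close>

lemma adj_trans_in_nbhd:
  assumes "adj x u" "adj x v" "adj x w" "adj u v" "adj v w"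
  shows "u = w \<or> adj u w"
  using fc_triangle[OF assms(1,2,4)] fc_triangle[OF assms(2,3,5)] fc_eq_adj[OF assms(1,3)] by simp

text \<open>\<open>reduced_walk x c u v\<close>: some walk starts at \<open>x\<close> through the cut \<open>c\<close>, ends with the step from
  \<open>u\<close> to \<open>v\<close>, and follows a path without backtracking in the structure tree.\<close>

inductive reduced_walk :: "'a \<Rightarrow> 'a set \<Rightarrow> 'a \<Rightarrow> 'a \<Rightarrow> bool" for x c where
  start: "adj x p \<Longrightarrow> fc x p = c \<Longrightarrow> reduced_walk x c x p"
| step: "reduced_walk x c u v \<Longrightarrow> adj v w \<Longrightarrow> fc v u \<noteq> fc v w \<Longrightarrow> reduced_walk x c v w"

lemma reduced_walk_adj: "reduced_walk x c u v \<Longrightarrow> adj u v"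
  by (induction rule: reduced_walk.induct) auto

text \<open>Different edges at one tree vertex, each taken with the side of that vertex, cover
  everything: both are minimal choices of \<open>v\<close>, so neither contains the other, and two
  choices of \<open>v\<close> cannot be disjoint.\<close>

lemma fc_other_side:
  assumes vu: "adj v u" and vw: "adj v w" and ne: "fc v u \<noteq> fc v w"
  shows "V - fc v w \<subseteq> fc v u"
proof -
  have V: "v \<in> V" using adj_V vu by blast
  have E: "fc v u \<in> \<E>" "fc v w \<in> \<E>" using fc(1) vu vw \<sigma>D(1)[OF V] by blast+
  have "fc v u \<inter> fc v w \<noteq> {}"
  proof
    assume "fc v u \<inter> fc v w = {}"
    then have "fc v u \<subseteq> V - fc v w" using cut[OF E(1)] by blast
    then have "V - fc v w \<in> \<sigma> v" using \<sigma>D(3)[OF V fc(1)[OF vu] compl[OF E(2)]] by blast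
    then show False using \<sigma>D(2)[OF V E(2)] fc(1)[OF vw] by blast
  qed
  moreover have "\<not> fc v u \<subseteq> fc v w" "\<not> fc v w \<subseteq> fc v u"
    using fc_minimal[OF vu fc(1)[OF vw]] fc_minimal[OF vw fc(1)[OF vu]] ne by auto
  ultimately show ?thesis using nest[OF E] by blast
qed

text \<open>Looking back from the end of the walk, the side of the last step shrinks with every
  step, so it stays within the region beyond \<open>c\<close>.\<close>

lemma reduced_walk_side: "reduced_walk x c u v \<Longrightarrow> fc v u \<subseteq> V - c"
proof (induction rule: reduced_walk.induct)
  case (start p)
  then show ?case using fc_opposite by blast
next
  case (step u v w)
  have "fc w v \<subseteq> V - fc v w" using fc_opposite step by blast
  also have "\<dots> \<subseteq> fc v u" using fc_other_side[of v u w] step reduced_walk_adj adj_sym by blast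
  finally show ?case using step by blast
qed

lemma reduced_walk_start: "reduced_walk x c u v \<Longrightarrow> c \<in> \<sigma> x"
  by (induction rule: reduced_walk.induct) (auto simp: fc)

text \<open>The image of the end of the walk lies beyond \<open>c\<close>, that of \<open>x\<close>
  before it.\<close>

lemma reduced_walk_not_closed:
  assumes w: "reduced_walk x c u v" shows "v \<noteq> x"
proof
  assume "v = x"
  have uv: "adj v u" using reduced_walk_adj[OF w] adj_sym by blast
  have V: "v \<in> V" using adj_V uv by blast
  have c: "c \<in> \<sigma> v" using reduced_walk_start[OF w] \<open>v = x\<close> by simp
  then have cE: "c \<in> \<E>" using \<sigma>D(1)[OF V] by blast
  then have "V - c \<in> \<sigma> v" using \<sigma>D(3)[OF V fc(1)[OF uv] compl reduced_walk_side[OF w]] by blast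
  then show False using \<sigma>D(2)[OF V cE] c by blast
qed

text \<open>A walk avoiding \<open>x\<close> is kept reduced as it grows. If the step from
  \<open>v\<close> to \<open>w\<close> backtracks toward the previous vertex \<open>u\<close>, then
  \<open>w = u\<close> or \<open>adj u w\<close>: either the last step is cancelled, or the steps to
  \<open>v\<close> and \<open>w\<close> are replaced by one from \<open>u\<close> to
  \<open>w\<close>, which has the same first edge as that from \<open>u\<close> to
  \<open>v\<close>.\<close>

lemma reduced_walk_reaches:
  assumes xy: "adj x y" and reach: "(\<lambda>u v. u \<noteq> x \<and> v \<noteq> x \<and> adj u v)\<^sup>*\<^sup>* y v"
  shows "\<exists>u. reduced_walk x (fc x y) u v"
  using reach
proof (induction rule: rtranclp_induct)
  case base
  then show ?case using start[OF xy refl] by blast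
next
  case (step v w)
  then obtain u where u: "reduced_walk x (fc x y) u v" by blast
  have vw: "adj v w" and wx: "w \<noteq> x" using step by auto
  show ?case
  proof (cases "fc v u = fc v w")
    case False
    then show ?thesis using reduced_walk.step[OF u vw] by blast
  next
    case True
    have uv: "adj u v" using reduced_walk_adj[OF u] .
    then have wu: "u = w \<or> adj u w" using True fc_eq_iff[of v u w] vw adj_sym by blast
    show ?thesis
      using u
    proof cases
      case start
      then show ?thesis using wu wx fc_eq_iff[of x v w] uv vw reduced_walk.start[of x w "fc x y"] by auto
    next
      case (step t)
      show ?thesis
      proof (cases "u = w")
        case True
        then show ?thesis using step by blast
      next
        case False
        then have "fc u w = fc u v" using wu fc_eq_iff[of u w v] uv vw adj_sym by blast
        then show ?thesis using reduced_walk.step[OF step(1), of w] step wu False by auto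
      qed
    qed
  qed
qed

text \<open>If the reduced walk to \<open>z\<close> had several steps, it could be closed up to a
  reduced walk back to \<open>x\<close>: by the step from \<open>z\<close> to \<open>x\<close> or,
  if that backtracks, by going from the last vertex \<open>u\<close> before \<open>z\<close>
  straight to \<open>x\<close>. So it is a single step, and \<open>z\<close> has the same first edge
  as \<open>y\<close>.\<close>

lemma nbrs_separated:
  assumes xy: "adj x y" and xz: "adj x z" and reach: "(\<lambda>u v. u \<noteq> x \<and> v \<noteq> x \<and> adj u v)\<^sup>*\<^sup>* y z"
  shows "y = z \<or> adj y z"
proof -
  obtain u where u: "reduced_walk x (fc x y) u z" using reduced_walk_reaches[OF xy reach] by blast
  show ?thesis
    using u
  proof cases
    case start
    then show ?thesis using fc_eq_iff[OF xy xz] by simp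
  next
    case (step t)
    have ux: "u \<noteq> x" using reduced_walk_not_closed[OF step(1)] .
    have "fc z u = fc z x"
      using reduced_walk_not_closed[OF reduced_walk.step[OF u adj_sym[OF xz]]] by blast
    then have "adj u x" using fc_eq_iff[of z u x] step adj_sym xz ux by blast
    then have "fc u x = fc u z" using fc_triangle[of u x z] step xz by blast
    then have "reduced_walk x (fc x y) u x" using reduced_walk.step[OF step(1) \<open>adj u x\<close>] step by simp
    then show ?thesis using reduced_walk_not_closed by blast
  qed
qed

section \<open>Counting third vertices over an arc\<close>

lemma common_nbr_card_arc:
  assumes "A u v" "A u' v'"
    and inv: "\<And>g u v w. automorphism V A g \<Longrightarrow> u \<in> V \<Longrightarrow> v \<in> V \<Longrightarrow> w \<in> V \<Longrightarrow> P (g u) (g v) (g w) \<longleftrightarrow> P u v w"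
    and PV: "\<And>u v w. P u v w \<Longrightarrow> w \<in> V"
  shows "card {w. P u' v' w} = card {w. P u v w}"
proof -
  obtain g where g: "automorphism V A g" "g u = u'" "g v = v'" using arc_transitive[OF assms(1,2)] .
  have V: "u \<in> V" "v \<in> V" using arc_V assms by auto
  have inj: "inj_on g V" and im: "g ` V = V" using aut_bij[OF g(1)] by (auto simp: bij_betw_def)
  have "{w. P u' v' w} = g ` {w. P u v w}"
  proof
    show "g ` {w. P u v w} \<subseteq> {w. P u' v' w}" using inv[OF g(1) V] PV g by auto
    show "{w. P u' v' w} \<subseteq> g ` {w. P u v w}"
    proof
      fix w assume w: "w \<in> {w. P u' v' w}"
      then obtain w0 where "w0 \<in> V" "w = g w0" using PV im by blast
      then show "w \<in> g ` {w. P u v w}" using w inv[OF g(1) V] g by auto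
    qed
  qed
  moreover have "inj_on g {w. P u v w}" using PV by (intro inj_on_subset[OF inj]) auto
  ultimately show ?thesis by (simp add: card_image)
qed

text \<open>The set of all third vertices of triangles of a fixed type over an arc \<open>u v\<close> is a vertex
  transitive tournament.\<close>

lemma odd_card_third_vertices:
  assumes uv: "A u v" and a: "(a = A \<or> a = A\<inverse>\<inverse>)" and b: "(b = A \<or> b = A\<inverse>\<inverse>)"
    and S: "S = {w. a u w \<and> b v w}" "S \<noteq> {}"
  shows "odd (card S)"
proof -
  have adjS: "adj u w" "adj v w" if "w \<in> S" for w using that a b S by (auto simp: uadj_def)
  have V: "u \<in> V" "v \<in> V" "S \<subseteq> V" using arc_V[OF uv] adjS adj_V by blast+
  have auv: "adj u v" using uv by (simp add: uadj_def)
  have "S \<subseteq> {w. A u w} \<union> {w. A w u}" using adjS by (auto simp: uadj_def)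
  then have fin: "finite S" using lf V unfolding locally_finite_def by (meson finite_UnI finite_subset)
  obtain w0 where w0: "w0 \<in> S" using S by blast
  have card: "card {t \<in> S. A w t} = card {t \<in> S. A w0 t}" if w: "w \<in> S" for w
  proof -
    have eqs: "A u w0 \<longleftrightarrow> A u w" "A v w0 \<longleftrightarrow> A v w" "A w0 v \<longleftrightarrow> A w v"
      using w w0 a b S arc_anti by auto
    obtain g where g: "automorphism V A g" "g u = u" "g v = v" "g w0 = w"
      using triple_transitive[of u v w0 u v w] auv adjS[OF w] adjS[OF w0] eqs arc_irr
      by (metis adj_irr)
    have inj: "inj_on g V" and im: "g ` V = V" using aut_bij[OF g(1)] by (auto simp: bij_betw_def)
    have mem: "g t \<in> S \<longleftrightarrow> t \<in> S" if "t \<in> V" for t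
      using aut_arc[OF g(1)] that V a b S g by auto (metis+)?
    have "{t \<in> S. A w t} = g ` {t \<in> S. A w0 t}"
    proof
      show "g ` {t \<in> S. A w0 t} \<subseteq> {t \<in> S. A w t}"
        using mem aut_arc[OF g(1), of w0] V w0 g by auto
      show "{t \<in> S. A w t} \<subseteq> g ` {t \<in> S. A w0 t}"
      proof
        fix t assume t: "t \<in> {t \<in> S. A w t}"
        then obtain t0 where "t0 \<in> V" "t = g t0" using V im by blast
        then show "t \<in> g ` {t \<in> S. A w0 t}" using t mem aut_arc[OF g(1), of w0 t0] V w0 g by auto
      qed
    qed
    moreover have "inj_on g {t \<in> S. A w0 t}" using V by (intro inj_on_subset[OF inj]) auto
    ultimately show ?thesis by (simp add: card_image)
  qed
  have "card S = 2 * card {t \<in> S. A w0 t} + 1"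
  proof (rule card_regular_tournament[of S A])
    \<comment> \<open>Both \<open>s\<close> and \<open>t\<close> are adjacent to \<open>v\<close>
      within the neighbourhood of \<open>u\<close>, where adjacency is transitive.\<close>
    show "A s t \<or> A t s" if "s \<in> S" "t \<in> S" "s \<noteq> t" for s t
      using adj_trans_in_nbhd[of u s v t] adjS[OF that(1)] adjS[OF that(2)] auv adj_sym that(3)
      unfolding uadj_def by blast
  qed (use fin arc_irr arc_anti card S in auto)
  then show ?thesis by simp
qed

text \<open>Counting certain out-neighbours of the middle vertex of a path over either of its arcs
  gives \<open>1 + (card \<alpha> + card \<beta>) = card \<alpha> + card \<gamma>\<close>, each size
  being the same for all arcs. Nonempty classes \<open>\<beta>\<close> and \<open>\<gamma>\<close>
  have odd size, so \<open>\<beta>\<close> must be empty and \<open>\<gamma>\<close> a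
  singleton.\<close>

lemma unique_directed_triangle:
  assumes uv: "A u v"
  shows "\<exists>w. A v w \<and> A w u \<and> {w. adj u w \<and> adj v w} = {w}"
proof -
  define \<alpha> where "\<alpha> u v = {w. A u w \<and> A v w}" for u v
  define \<beta> where "\<beta> u v = {w. A u w \<and> A w v}" for u v
  define \<gamma> where "\<gamma> u v = {w. A w u \<and> A v w}" for u v
  have finite: "finite (\<alpha> u v)" "finite (\<beta> u v)" "finite (\<gamma> u v)" if "A u v" for u v
  proof -
    have "finite {w. A u w}" "finite {w. A w u}" using lf arc_V[OF that] by (auto simp: locally_finite_def)
    then show "finite (\<alpha> u v)" "finite (\<beta> u v)" "finite (\<gamma> u v)"
      unfolding \<alpha>_def \<beta>_def \<gamma>_def by (auto intro: rev_finite_subset)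
  qed
  have cst: "card (\<alpha> a b) = card (\<alpha> u v)" "card (\<beta> a b) = card (\<beta> u v)" "card (\<gamma> a b) = card (\<gamma> u v)"
    if "A a b" for a b
    unfolding \<alpha>_def \<beta>_def \<gamma>_def
    using that uv by (auto intro!: common_nbr_card_arc simp: aut_arc arc_V)
  obtain x y t where xyt: "A x y" "A y t" "adj x t" using ex_path_in_triangle by blast
  have adj: "adj y t" "adj y x" "adj t x" using xyt by (auto simp: uadj_def)
  \<comment> \<open>The \<open>w\<close> in question are the out-neighbours of \<open>y\<close> in
    the clique of \<open>x\<close>, \<open>y\<close> and \<open>t\<close>, described once over the
    arc from \<open>y\<close> to \<open>t\<close> and once over that from \<open>x\<close> to
    \<open>y\<close>.\<close>
  have nb: "w = t \<or> adj w t \<longleftrightarrow> adj w x" if yw: "A y w" for w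
  proof -
    have "adj y w" using yw by (simp add: uadj_def)
    moreover have "w \<noteq> x" using yw xyt arc_anti by blast
    ultimately show ?thesis
      using adj adj_trans_in_nbhd[of y w t x] adj_trans_in_nbhd[of y w x t] adj_sym by blast
  qed
  have "insert t (\<alpha> y t \<union> \<beta> y t) = \<alpha> x y \<union> \<gamma> x y"
    using nb xyt(2) unfolding \<alpha>_def \<beta>_def \<gamma>_def uadj_def by blast
  moreover have "card (insert t (\<alpha> y t \<union> \<beta> y t)) = 1 + (card (\<alpha> y t) + card (\<beta> y t))"
    using finite[OF xyt(2)] arc_irr arc_anti
    by (subst card_insert_disjoint; (subst card_Un_disjoint)?) (auto simp: \<alpha>_def \<beta>_def)
  moreover have "card (\<alpha> x y \<union> \<gamma> x y) = card (\<alpha> x y) + card (\<gamma> x y)"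
    using finite[OF xyt(1)] arc_anti by (subst card_Un_disjoint) (auto simp: \<alpha>_def \<gamma>_def)
  ultimately have bg: "card (\<gamma> u v) = 1 + card (\<beta> u v)" using cst[OF xyt(1)] cst[OF xyt(2)] by simp
  have "\<gamma> u v \<noteq> {}" using bg by auto
  then have "odd (card (\<gamma> u v))"
    by (intro odd_card_third_vertices[OF uv, of "A\<inverse>\<inverse>" A]) (auto simp: \<gamma>_def)
  moreover have "odd (card (\<beta> u v))" if "\<beta> u v \<noteq> {}"
    by (rule odd_card_third_vertices[OF uv, of A "A\<inverse>\<inverse>"]) (use that in \<open>auto simp: \<beta>_def\<close>)
  ultimately have "\<beta> u v = {}" using bg by auto
  then have card0: "card (\<beta> a b) = 0" if "A a b" for a b using cst[OF that] by simp
  have no: "\<beta> a b = {}" if "A a b" for a b using card0[OF that] finite[OF that] by simp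
  have "card (\<gamma> u v) = 1" using bg card0[OF uv] by simp
  then obtain w where w: "\<gamma> u v = {w}" using card_1_singletonE by blast
  \<comment> \<open>A third vertex of any other type makes the triangle transitive, and then one of
    its arcs has a nonempty \<open>\<beta>\<close>.\<close>
  have "z \<in> \<gamma> u v" if "adj u z" "adj v z" for z
    using that uv no[of u v] no[of u z] no[of v z] no[of z v] no[of z u]
    unfolding \<beta>_def \<gamma>_def uadj_def by blast
  then have "{w. adj u w \<and> adj v w} = {w}" using w by (auto simp: \<gamma>_def uadj_def)
  then show ?thesis using w by (intro exI[of _ w]) (auto simp: \<gamma>_def)
qed

end

section \<open>Triangle trees\<close>

text \<open>Serves to compare the numbers of occupied triangles at a vertex and at its image, where
  two indexings are known to identify the same pairs.\<close>

lemma card_image_same_kernel: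
  assumes "\<And>a b. a \<in> S \<Longrightarrow> b \<in> S \<Longrightarrow> f a = f b \<longleftrightarrow> h a = h b"
  shows "card (f ` S) = card (h ` S)"
proof -
  let ?k = "\<lambda>y. h (inv_into S f y)"
  have k: "?k (f a) = h a" if "a \<in> S" for a
    using assms[of "inv_into S f (f a)" a] that by (simp add: inv_into_into f_inv_into_f)
  have "bij_betw ?k (f ` S) (h ` S)"
    unfolding bij_betw_def
  proof
    show "inj_on ?k (f ` S)"
      using k assms by (auto simp: inj_on_def)
    show "?k ` f ` S = h ` S"
      using k by (auto simp: image_image)
  qed
  then show ?thesis by (rule bij_betw_same_card)
qed

lemma uconnected_on_image:
  assumes "uconnected_on X A" and "\<And>x y. x \<in> X \<Longrightarrow> y \<in> X \<Longrightarrow> uadj A x y \<Longrightarrow> uadj B (f x) (f y)"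
  shows "uconnected_on (f ` X) B"
proof -
  have "(\<lambda>u v. u \<in> f ` X \<and> v \<in> f ` X \<and> uadj B u v)\<^sup>*\<^sup>* (f x) (f y)"
    if "(\<lambda>u v. u \<in> X \<and> v \<in> X \<and> uadj A u v)\<^sup>*\<^sup>* x y" for x y
    using that
  proof (induction rule: rtranclp_induct)
    case (step y z)
    then show ?case using assms(2) by (auto intro: rtranclp.rtrancl_into_rtrancl)
  qed simp
  then show ?thesis using assms(1) by (auto simp: uconnected_on_def)
qed

lemma uconnected_on_insert:
  assumes "uconnected_on X A" "x \<in> X" "uadj A x v"
  shows "uconnected_on (insert v X) A"
proof -
  let ?R = "\<lambda>a b. a \<in> insert v X \<and> b \<in> insert v X \<and> uadj A a b"
  have X: "?R\<^sup>*\<^sup>* a b" if "a \<in> X" "b \<in> X" for a b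
  proof -
    have "(\<lambda>a b. a \<in> X \<and> b \<in> X \<and> uadj A a b)\<^sup>*\<^sup>* a b"
      using assms(1) that by (auto simp: uconnected_on_def)
    then show ?thesis by (rule mono_rtranclp[rule_format, rotated]) auto
  qed
  have "?R v x" "?R x v" using assms by (auto simp: uadj_sym)
  then have vx: "?R\<^sup>*\<^sup>* v x" "?R\<^sup>*\<^sup>* x v" by blast+
  show ?thesis
    unfolding uconnected_on_def
  proof (intro ballI)
    fix a b assume ab: "a \<in> insert v X" "b \<in> insert v X"
    have "?R\<^sup>*\<^sup>* a x" using ab X[of a x] vx assms(2) by (cases "a = v") auto
    moreover have "?R\<^sup>*\<^sup>* x b" using ab X[of x b] vx assms(2) by (cases "b = v") auto
    ultimately show "?R\<^sup>*\<^sup>* a b" by (rule rtranclp_trans)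
  qed
qed

locale triangle_tree =
  fixes V :: "'a set" and A :: "'a \<Rightarrow> 'a \<Rightarrow> bool" and r :: nat
  assumes dg: "digraph V A" and con: "connected_digraph V A"
    and outdeg: "x \<in> V \<Longrightarrow> finite {y. A x y} \<and> card {y. A x y} = r"
    and triangle: "A x y \<Longrightarrow> \<exists>z. A y z \<and> A z x"
    and common_nbr_unique: "uadj A x y \<Longrightarrow> uadj A x z \<Longrightarrow> uadj A y z \<Longrightarrow> uadj A x w \<Longrightarrow> uadj A y w \<Longrightarrow> z = w"
    and separated: "uadj A x y \<Longrightarrow> uadj A x z \<Longrightarrow> (\<lambda>u v. u \<noteq> x \<and> v \<noteq> x \<and> uadj A u v)\<^sup>*\<^sup>* y z \<Longrightarrow>
      y = z \<or> uadj A y z"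
begin

lemma arc_V: "A x y \<Longrightarrow> x \<in> V \<and> y \<in> V" and arc_irr: "\<not> A x x" and arc_anti: "A x y \<Longrightarrow> \<not> A y x"
  using dg unfolding digraph_def by blast+

text \<open>With uniqueness of common neighbours, a vertex outside a connected set has at most two
  neighbours in it, which keeps the extension of partial isomorphisms down to two cases.\<close>

lemma nbrs_in_connected_set:
  assumes "uconnected_on X A" "v \<notin> X" "y \<in> X" "z \<in> X" "uadj A v y" "uadj A v z"
  shows "y = z \<or> uadj A y z"
proof (rule separated[OF assms(5,6)])
  have "(\<lambda>u v. u \<in> X \<and> v \<in> X \<and> uadj A u v)\<^sup>*\<^sup>* y z" using assms by (auto simp: uconnected_on_def)
  then show "(\<lambda>a b. a \<noteq> v \<and> b \<noteq> v \<and> uadj A a b)\<^sup>*\<^sup>* y z"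
    by (rule mono_rtranclp[rule_format, rotated]) (use assms(2) in auto)
qed

text \<open>The triangles at \<open>x\<close> are indexed by the out-neighbours of \<open>x\<close>; \<open>tri_rep x w\<close> is the index of the
  triangle through the edge \<open>x w\<close>.\<close>

definition tri_rep :: "'a \<Rightarrow> 'a \<Rightarrow> 'a" where
  "tri_rep x w = (if A x w then w else (THE u. A x u \<and> A u w))"

lemma tri_rep_in: 
  assumes "A w x" shows "A x (tri_rep x w) \<and> A (tri_rep x w) w"
proof -
  obtain u where u: "A x u" "A u w" using triangle[OF assms] by blast
  have "(THE u. A x u \<and> A u w) = u"
    by (rule the_equality) (use u assms common_nbr_unique[of x w] in \<open>auto simp: uadj_def\<close>)
  then show ?thesis using u arc_anti[OF assms] by (simp add: tri_rep_def)
qed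

lemma tri_rep_out: "A x w \<Longrightarrow> tri_rep x w = w"
  by (simp add: tri_rep_def)

lemma tri_rep_arc: "uadj A x w \<Longrightarrow> A x (tri_rep x w)"
  using tri_rep_in tri_rep_out by (auto simp: uadj_def)

lemma tri_rep_eq_or_adj: "uadj A x w \<Longrightarrow> tri_rep x w = w \<or> uadj A (tri_rep x w) w"
  using tri_rep_in tri_rep_out by (auto simp: uadj_def)

lemma tri_rep_unique:
  assumes "uadj A x w" "A x u" "uadj A u w" shows "tri_rep x w = u"
proof (cases "A x w")
  case True
  obtain z where z: "A w z" "A z x" using triangle[OF True] by blast
  have "z = u" using common_nbr_unique[of x w z u] z assms by (auto simp: uadj_def)
  then show ?thesis using z assms arc_anti by blast
next
  case False
  then have "A w x" using assms by (auto simp: uadj_def)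
  then show ?thesis
    using tri_rep_in[of w x] common_nbr_unique[of x w u "tri_rep x w"] assms by (auto simp: uadj_def)
qed

lemma tri_rep_eq_iff:
  assumes a: "uadj A x a" and b: "uadj A x b"
  shows "tri_rep x a = tri_rep x b \<longleftrightarrow> a = b \<or> uadj A a b"
proof
  assume eq: "tri_rep x a = tri_rep x b"
  show "a = b \<or> uadj A a b"
  proof (rule ccontr)
    assume n: "\<not> (a = b \<or> uadj A a b)"
    then have "uadj A (tri_rep x a) a" "uadj A (tri_rep x a) b"
      using tri_rep_eq_or_adj[OF a] tri_rep_eq_or_adj[OF b] eq by (auto simp: uadj_def)
    then have "a = b" using common_nbr_unique[of x "tri_rep x a" a b] tri_rep_arc[OF a] a b
      by (auto simp: uadj_def)
    then show False using n by simp
  qed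
next
  assume "a = b \<or> uadj A a b"
  then show "tri_rep x a = tri_rep x b"
  proof
    assume ab: "uadj A a b"
    show ?thesis
    proof (cases "tri_rep x a = a")
      case True
      then have "A x a" using tri_rep_arc[OF a] by simp
      then show ?thesis using tri_rep_unique[OF b _ ab] True by simp
    next
      case False
      then have "b = tri_rep x a"
        using tri_rep_eq_or_adj[OF a] tri_rep_arc[OF a] common_nbr_unique[of x a b "tri_rep x a"] a b ab
        by (auto simp: uadj_def)
      then show ?thesis using tri_rep_out[of x b] tri_rep_arc[OF a] by simp
    qed
  qed simp
qed

text \<open>A free triangle can accommodate a new neighbour whichever way its arc points.\<close>

lemma ex_nbr_in_triangle:
  assumes "A x u"
  shows "\<exists>v. A x v \<and> tri_rep x v = u" "\<exists>v. A v x \<and> tri_rep x v = u"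
proof -
  show "\<exists>v. A x v \<and> tri_rep x v = u" using assms tri_rep_out by blast
  obtain v where "A u v" "A v x" using triangle[OF assms] by blast
  then show "\<exists>v. A v x \<and> tri_rep x v = u" using tri_rep_unique[of x v u] assms by (auto simp: uadj_def)
qed

end

section \<open>Extension of partial isomorphisms\<close>

definition partial_iso :: "('a \<Rightarrow> 'a \<Rightarrow> bool) \<Rightarrow> ('b \<Rightarrow> 'b \<Rightarrow> bool) \<Rightarrow> ('a \<times> 'b) set \<Rightarrow> bool" where
  "partial_iso A B R \<longleftrightarrow> (\<forall>(x, x')\<in>R. \<forall>(y, y')\<in>R. (x = y \<longleftrightarrow> x' = y') \<and> (A x y \<longleftrightarrow> B x' y')) \<and>
     uconnected_on (Domain R) A"

lemma partial_isoD:
  assumes "partial_iso A B R" "(x, x') \<in> R" "(y, y') \<in> R"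
  shows "x = y \<longleftrightarrow> x' = y'" "A x y \<longleftrightarrow> B x' y'" "uadj A x y \<longleftrightarrow> uadj B x' y'"
  using assms unfolding partial_iso_def uadj_def by fast+

text \<open>Partial isomorphisms are relations so that inverting is taking the converse; one
  extension lemma then serves both domain and range.\<close>

lemma partial_iso_converse:
  assumes R: "partial_iso A B R"
  shows "partial_iso B A (R\<inverse>)"
proof -
  define f where "f x = (THE x'. (x, x') \<in> R)" for x
  have f: "f x = x'" if "(x, x') \<in> R" for x x'
    unfolding f_def by (rule the_equality) (use partial_isoD(1)[OF R that] that in auto)
  have "Range R = f ` Domain R" using f by force
  moreover have "uconnected_on (f ` Domain R) B"
    by (rule uconnected_on_image[of _ A]) (use R f partial_isoD(3)[OF R] in \<open>auto simp: partial_iso_def\<close>)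
  ultimately have "uconnected_on (Domain (R\<inverse>)) B" by simp
  then show ?thesis using R unfolding partial_iso_def by fast
qed

lemma partial_iso_extend:
  assumes V: "triangle_tree V A r" and W: "triangle_tree W B r" and R: "partial_iso A B R"
    and xx': "(x, x') \<in> R" and RVW: "R \<subseteq> V \<times> W" and v: "v \<notin> Domain R" and xv: "uadj A x v"
  shows "\<exists>v'. (v, v') \<in> V \<times> W \<and> partial_iso A B (insert (v, v') R)"
proof -
  interpret T: triangle_tree V A r by (rule V)
  interpret U: triangle_tree W B r by (rule W)
  have conD: "uconnected_on (Domain R) A" using R by (simp add: partial_iso_def)
  have conR: "uconnected_on (Range R) B" using partial_iso_converse[OF R] by (simp add: partial_iso_def)
  have ins: ?thesis if v': "v' \<notin> Range R"
    and new: "\<And>w w'. (w, w') \<in> R \<Longrightarrow> (A w v \<longleftrightarrow> B w' v') \<and> (A v w \<longleftrightarrow> B v' w')" for v'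
  proof -
    have vV: "v \<in> V" using xv T.arc_V by (auto simp: uadj_def)
    have "uadj B x' v'" using new[OF xx'] xv by (auto simp: uadj_def)
    then have "v' \<in> W" using U.arc_V by (auto simp: uadj_def)
    moreover have "partial_iso A B (insert (v, v') R)"
      unfolding partial_iso_def
    proof
      show "uconnected_on (Domain (insert (v, v') R)) A"
        using uconnected_on_insert[OF conD _ xv] xx' by auto
      have old: "(a = b \<longleftrightarrow> a' = b') \<and> (A a b \<longleftrightarrow> B a' b')" if "(a, a') \<in> R" "(b, b') \<in> R" for a a' b b'
        using partial_isoD[OF R that] by blast
      have nv: "a \<noteq> v" "a' \<noteq> v'" if "(a, a') \<in> R" for a a' using that v v' by auto
      show "\<forall>(a, a')\<in>insert (v, v') R. \<forall>(b, b')\<in>insert (v, v') R. (a = b \<longleftrightarrow> a' = b') \<and> (A a b \<longleftrightarrow> B a' b')"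
      proof (intro ballI, clarify)
        fix a a' b b' assume "(a, a') \<in> insert (v, v') R" "(b, b') \<in> insert (v, v') R"
        then show "(a = b \<longleftrightarrow> a' = b') \<and> (A a b \<longleftrightarrow> B a' b')"
          using old[of a a' b b'] new[of a a'] new[of b b'] nv[of a a'] nv[of b b']
            T.arc_irr[of v] U.arc_irr[of v'] by blast
      qed
    qed
    ultimately show ?thesis using vV by blast
  qed
  show ?thesis
  proof (cases "\<exists>y y'. (y, y') \<in> R \<and> y \<noteq> x \<and> uadj A y v")
    case True
    then obtain y y' where yy': "(y, y') \<in> R" "y \<noteq> x" "uadj A y v" by blast
    have xy: "uadj A x y"
      using T.nbrs_in_connected_set[OF conD v, of x y] xx' yy' xv uadj_sym by (metis Domain.DomainI)
    have xy': "uadj B x' y'" using partial_isoD(3)[OF R xx' yy'(1)] xy by simp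
    have D: "A x v \<and> A v y \<and> A y x \<or> A v x \<and> A y v \<and> A x y"
    proof (cases "A x v")
      case True
      then obtain z where z: "A v z" "A z x" using T.triangle by blast
      then have "z = y" using T.common_nbr_unique[of x v z y] True xy yy' by (auto simp: uadj_def)
      then show ?thesis using z True by blast
    next
      case False
      then have vx: "A v x" using xv by (auto simp: uadj_def)
      then obtain z where z: "A x z" "A z v" using T.triangle by blast
      then have "z = y" using T.common_nbr_unique[of x v z y] vx xy yy' by (auto simp: uadj_def)
      then show ?thesis using z vx by blast
    qed
    then obtain v' where D': "(A x v \<and> A v y \<and> B x' v' \<and> B v' y') \<or> (A v x \<and> A y v \<and> B v' x' \<and> B y' v')"
      using partial_isoD(2)[OF R xx' yy'(1)] partial_isoD(2)[OF R yy'(1) xx'] U.triangle by meson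
    have adj': "uadj B x' v'" "uadj B y' v'" using D' by (auto simp: uadj_def)
    have nR: "v' \<notin> Range R"
    proof
      assume "v' \<in> Range R"
      then obtain w where w: "(w, v') \<in> R" by blast
      then have "uadj A x w" "uadj A y w" using partial_isoD(3)[OF R _ w] xx' yy' adj' by blast+
      then have "w = v" using T.common_nbr_unique[OF xy] xv yy' by blast
      then show False using w v by blast
    qed
    show ?thesis
    proof (rule ins[OF nR])
      fix w w' assume w: "(w, w') \<in> R"
      show "(A w v \<longleftrightarrow> B w' v') \<and> (A v w \<longleftrightarrow> B v' w')"
      proof (cases "w = x \<or> w = y")
        case True
        then have "w = x \<and> w' = x' \<or> w = y \<and> w' = y'"
          using partial_isoD(1)[OF R w xx'] partial_isoD(1)[OF R w yy'(1)] by blast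
        then show ?thesis using D' T.arc_anti U.arc_anti by blast
      next
        case False
        have "\<not> uadj A v w"
        proof
          assume vw: "uadj A v w"
          have "uadj A x w"
            using T.nbrs_in_connected_set[OF conD v, of x w] xx' w vw xv False uadj_sym by (metis Domain.DomainI)
          then have "w = y" using T.common_nbr_unique[of x v w y] xv vw xy yy'(3) uadj_sym by metis
          then show False using False by blast
        qed
        moreover have "\<not> uadj B v' w'"
        proof
          assume vw: "uadj B v' w'"
          have ne: "w' \<noteq> x'" "w' \<noteq> y'"
            using partial_isoD(1)[OF R w xx'] partial_isoD(1)[OF R w yy'(1)] False by auto
          have "uadj B x' w'"
            using U.nbrs_in_connected_set[OF conR nR, of x' w'] xx' w vw adj' ne uadj_sym by (metis Range.RangeI)
          then have "w' = y'" using U.common_nbr_unique[of x' v' w' y'] adj' vw xy' uadj_sym by metis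
          then show False using ne by blast
        qed
        ultimately show ?thesis by (auto simp: uadj_def)
      qed
    qed
  next
    case False
    define S where "S = {(w, w') \<in> R. uadj A x w}"
    have SB: "uadj B x' w'" if "(w, w') \<in> S" for w w'
      using that partial_isoD(3)[OF R xx'] by (auto simp: S_def)
    have xV: "x \<in> V" "x' \<in> W" using xx' RVW by auto
    \<comment> \<open>Two neighbours share a triangle exactly when they are equal or adjacent, and
      the partial isomorphism preserves this.\<close>
    have "card ((\<lambda>(w, w'). T.tri_rep x w) ` S) = card ((\<lambda>(w, w'). U.tri_rep x' w') ` S)"
    proof (rule card_image_same_kernel, clarify)
      fix a a' b b' assume ab: "(a, a') \<in> S" "(b, b') \<in> S"
      then show "T.tri_rep x a = T.tri_rep x b \<longleftrightarrow> U.tri_rep x' a' = U.tri_rep x' b'"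
        using T.tri_rep_eq_iff[of x a b] U.tri_rep_eq_iff[of x' a' b'] SB[OF ab(1)] SB[OF ab(2)]
          partial_isoD[OF R, of a a' b b'] by (auto simp: S_def)
    qed
    moreover have "(\<lambda>(w, w'). T.tri_rep x w) ` S \<subset> {u. A x u}"
    proof
      show "(\<lambda>(w, w'). T.tri_rep x w) ` S \<subseteq> {u. A x u}" using T.tri_rep_arc by (auto simp: S_def)
      have "T.tri_rep x v \<notin> (\<lambda>(w, w'). T.tri_rep x w) ` S"
      proof
        assume "T.tri_rep x v \<in> (\<lambda>(w, w'). T.tri_rep x w) ` S"
        then obtain w w' where w: "(w, w') \<in> S" "T.tri_rep x v = T.tri_rep x w" by auto
        then have "v = w \<or> uadj A v w" using T.tri_rep_eq_iff[OF xv, of w] by (auto simp: S_def)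
        moreover have "v \<noteq> w" using w v by (auto simp: S_def)
        moreover have "w \<noteq> x" using w T.arc_irr by (auto simp: S_def uadj_def)
        ultimately show False using False w by (auto simp: S_def uadj_def)
      qed
      then show "(\<lambda>(w, w'). T.tri_rep x w) ` S \<noteq> {u. A x u}" using T.tri_rep_arc[OF xv] by blast
    qed
    then have "card ((\<lambda>(w, w'). T.tri_rep x w) ` S) < r"
      using T.outdeg[OF xV(1)] psubset_card_mono[of "{u. A x u}"] by metis
    ultimately have lt: "card ((\<lambda>(w, w'). U.tri_rep x' w') ` S) < card {u. B x' u}"
      using U.outdeg[OF xV(2)] by simp
    obtain u where u: "B x' u" "u \<notin> (\<lambda>(w, w'). U.tri_rep x' w') ` S"
    proof -
      have "\<not> {u. B x' u} \<subseteq> (\<lambda>(w, w'). U.tri_rep x' w') ` S"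
      proof
        assume sub: "{u. B x' u} \<subseteq> (\<lambda>(w, w'). U.tri_rep x' w') ` S"
        have "(\<lambda>(w, w'). U.tri_rep x' w') ` S \<subseteq> {u. B x' u}" using U.tri_rep_arc SB by auto
        then show False using sub lt by (metis less_irrefl subset_antisym)
      qed
      then show ?thesis using that by blast
    qed
    obtain v' where v': "A x v \<and> B x' v' \<or> A v x \<and> B v' x'" "U.tri_rep x' v' = u"
      using U.ex_nbr_in_triangle[OF u(1)] xv unfolding uadj_def by blast
    have xv': "uadj B x' v'" using v' by (auto simp: uadj_def)
    have no: "\<not> (v' = w' \<or> uadj B v' w')" if w: "(w, w') \<in> R" "uadj B x' w'" for w w'
    proof
      assume "v' = w' \<or> uadj B v' w'"
      then have "U.tri_rep x' w' = u" using U.tri_rep_eq_iff[OF xv' w(2)] v'(2) by simp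
      moreover have "(w, w') \<in> S" using w partial_isoD(3)[OF R xx' w(1)] by (auto simp: S_def)
      ultimately show False using u(2) by force
    qed
    have nR: "v' \<notin> Range R" using no xv' by blast
    show ?thesis
    proof (rule ins[OF nR])
      fix w w' assume w: "(w, w') \<in> R"
      show "(A w v \<longleftrightarrow> B w' v') \<and> (A v w \<longleftrightarrow> B v' w')"
      proof (cases "w = x")
        case True
        then have "w' = x'" using partial_isoD(1)[OF R w xx'] by simp
        then show ?thesis using True v'(1) T.arc_anti U.arc_anti by blast
      next
        case wx: False
        then have "\<not> uadj A w v" using False w by blast
        moreover have "\<not> uadj B v' w'"
        proof
          assume vw: "uadj B v' w'"
          have "w' \<noteq> x'" using partial_isoD(1)[OF R w xx'] wx by simp
          then have "uadj B x' w'"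
            using U.nbrs_in_connected_set[OF conR nR, of x' w'] xx' w vw xv' uadj_sym by (metis Range.RangeI)
          then show False using no[OF w] vw by blast
        qed
        ultimately show ?thesis by (auto simp: uadj_def)
      qed
    qed
  qed
qed

lemma triangle_tree_boundary:
  assumes T: "triangle_tree V A r" and X: "X \<subseteq> V" "X \<noteq> {}" "X \<noteq> V"
  shows "\<exists>x v. x \<in> X \<and> v \<notin> X \<and> uadj A x v"
proof (rule ccontr)
  assume no: "\<not> ?thesis"
  obtain x y where xy: "x \<in> X" "y \<in> V" "y \<notin> X" using X by blast
  have "(\<lambda>u v. u \<in> V \<and> v \<in> V \<and> uadj A u v)\<^sup>*\<^sup>* x y"
    using triangle_tree.con[OF T] xy X by (auto simp: connected_digraph_def uconnected_on_def)
  then have "y \<in> X" using xy(1) no by (induction rule: rtranclp_induct) auto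
  then show False using xy by simp
qed

text \<open>A maximal extension is total and onto: by connectedness a missing vertex yields a
  missing one adjacent to the domain or range, where the extension lemma applies, on the range side
  to the converse.\<close>

lemma partial_iso_extends_to_iso:
  assumes V: "triangle_tree V A r" and W: "triangle_tree W B r"
    and R0: "partial_iso A B R\<^sub>0" "R\<^sub>0 \<subseteq> V \<times> W" "R\<^sub>0 \<noteq> {}"
  shows "\<exists>f. bij_betw f V W \<and> (\<forall>x\<in>V. \<forall>y\<in>V. A x y \<longleftrightarrow> B (f x) (f y)) \<and> (\<forall>(x, x')\<in>R\<^sub>0. f x = x')"
proof -
  define \<R> where "\<R> = {R. partial_iso A B R \<and> R \<subseteq> V \<times> W \<and> R\<^sub>0 \<subseteq> R}"
  have "\<exists>M\<in>\<R>. \<forall>X\<in>\<R>. M \<subseteq> X \<longrightarrow> X = M"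
  proof (rule subset_Zorn_nonempty)
    show "\<R> \<noteq> {}" using R0 by (auto simp: \<R>_def)
    fix \<C> assume ne: "\<C> \<noteq> {}" and ch: "subset.chain \<R> \<C>"
    have mem: "partial_iso A B R \<and> R \<subseteq> V \<times> W \<and> R\<^sub>0 \<subseteq> R" if "R \<in> \<C>" for R
      using ch that by (auto simp: subset_chain_def \<R>_def)
    have two: "\<exists>R\<in>\<C>. p \<in> R \<and> q \<in> R" if "p \<in> \<Union>\<C>" "q \<in> \<Union>\<C>" for p q
      using that ch unfolding subset_chain_def by blast
    have "partial_iso A B (\<Union>\<C>)"
      unfolding partial_iso_def
    proof
      show "\<forall>(x, x')\<in>\<Union>\<C>. \<forall>(y, y')\<in>\<Union>\<C>. (x = y \<longleftrightarrow> x' = y') \<and> (A x y \<longleftrightarrow> B x' y')"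
      proof clarsimp
        fix x x' y y' P Q assume "P \<in> \<C>" "(x, x') \<in> P" "Q \<in> \<C>" "(y, y') \<in> Q"
        then obtain R where R: "R \<in> \<C>" "(x, x') \<in> R" "(y, y') \<in> R" using two by blast
        show "(x = y \<longleftrightarrow> x' = y') \<and> (A x y \<longleftrightarrow> B x' y')"
          using partial_isoD(1,2)[OF _ R(2,3)] mem[OF R(1)] by blast
      qed
      show "uconnected_on (Domain (\<Union>\<C>)) A"
        unfolding uconnected_on_def
      proof (intro ballI)
        fix x y assume "x \<in> Domain (\<Union>\<C>)" "y \<in> Domain (\<Union>\<C>)"
        then obtain x' y' where "(x, x') \<in> \<Union>\<C>" "(y, y') \<in> \<Union>\<C>" by blast
        then obtain R where R: "R \<in> \<C>" "(x, x') \<in> R" "(y, y') \<in> R" using two by blast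
        have "(\<lambda>u v. u \<in> Domain R \<and> v \<in> Domain R \<and> uadj A u v)\<^sup>*\<^sup>* x y"
          using mem[OF R(1)] R unfolding partial_iso_def uconnected_on_def by blast
        then show "(\<lambda>u v. u \<in> Domain (\<Union>\<C>) \<and> v \<in> Domain (\<Union>\<C>) \<and> uadj A u v)\<^sup>*\<^sup>* x y"
          by (rule mono_rtranclp[rule_format, rotated]) (use R in blast)
      qed
    qed
    then show "\<Union>\<C> \<in> \<R>" using mem ne by (auto simp: \<R>_def)
  qed
  then obtain M where M: "partial_iso A B M" "M \<subseteq> V \<times> W" "R\<^sub>0 \<subseteq> M"
    and max: "\<And>X. partial_iso A B X \<Longrightarrow> X \<subseteq> V \<times> W \<Longrightarrow> M \<subseteq> X \<Longrightarrow> X = M"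
    unfolding \<R>_def by auto
  have dom: "Domain M = V"
  proof (rule ccontr)
    assume "Domain M \<noteq> V"
    then obtain x v where xv: "x \<in> Domain M" "v \<notin> Domain M" "uadj A x v"
      using triangle_tree_boundary[OF V, of "Domain M"] M R0 by blast
    then obtain x' where "(x, x') \<in> M" by blast
    then obtain v' where "(v, v') \<in> V \<times> W" "partial_iso A B (insert (v, v') M)"
      using partial_iso_extend[OF V W M(1) _ M(2) xv(2,3)] by blast
    then have "insert (v, v') M = M" using max M by auto
    then show False using xv by blast
  qed
  have ran: "Range M = W"
  proof (rule ccontr)
    assume "Range M \<noteq> W"
    then obtain x v where xv: "x \<in> Range M" "v \<notin> Range M" "uadj B x v"
      using triangle_tree_boundary[OF W, of "Range M"] M R0 by blast
    then obtain x' where "(x, x') \<in> M\<inverse>" by blast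
    then obtain v' where v': "(v, v') \<in> W \<times> V" "partial_iso B A (insert (v, v') (M\<inverse>))"
      using partial_iso_extend[OF W V partial_iso_converse[OF M(1)] _ _ _ xv(3)] M(2) xv(2) by blast
    have "(insert (v, v') (M\<inverse>))\<inverse> = insert (v', v) M" by auto
    then have "partial_iso A B (insert (v', v) M)" using partial_iso_converse[OF v'(2)] by simp
    then have "insert (v', v) M = M" using max M v' by auto
    then show False using xv by blast
  qed
  define f where "f x = (THE x'. (x, x') \<in> M)" for x
  have f: "f x = x'" if "(x, x') \<in> M" for x x'
    unfolding f_def by (rule the_equality) (use partial_isoD(1)[OF M(1) that] that in auto)
  have fM: "(x, f x) \<in> M" if "x \<in> V" for x using that dom f by blast
  have "f ` V = W" using dom ran f by force
  moreover have "inj_on f V"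
    using partial_isoD(1)[OF M(1) fM fM] by (auto simp: inj_on_def)
  moreover have "\<forall>x\<in>V. \<forall>y\<in>V. A x y \<longleftrightarrow> B (f x) (f y)" using partial_isoD(2)[OF M(1) fM fM] by blast
  moreover have "\<forall>(x, x')\<in>R\<^sub>0. f x = x'" using f M(3) by auto
  ultimately show ?thesis by (intro exI[of _ f]) (auto simp: bij_betw_def)
qed

lemma triangle_tree_iso:
  assumes V: "triangle_tree V A r" and W: "triangle_tree W B r"
  shows "digraph_iso V A W B"
proof -
  interpret T: triangle_tree V A r by (rule V)
  interpret U: triangle_tree W B r by (rule W)
  obtain x y where "x \<in> V" "y \<in> W" using T.con U.con by (auto simp: connected_digraph_def)
  then have "partial_iso A B {(x, y)}" "{(x, y)} \<subseteq> V \<times> W"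
    using T.arc_irr U.arc_irr by (auto simp: partial_iso_def uconnected_on_def)
  then show ?thesis
    using partial_iso_extends_to_iso[OF V W, of "{(x, y)}"] unfolding digraph_iso_def by blast
qed

lemma triangle_tree_homogeneous:
  assumes V: "triangle_tree V A r"
  shows "connected_homogeneous V A"
  unfolding connected_homogeneous_def
proof (intro allI impI, elim conjE)
  fix X Y f
  assume X: "X \<subseteq> V" and Y: "Y \<subseteq> V" and con: "uconnected_on X A"
    and f: "bij_betw f X Y" and arcs: "\<forall>x\<in>X. \<forall>y\<in>X. A x y \<longleftrightarrow> A (f x) (f y)"
  show "\<exists>g. automorphism V A g \<and> (\<forall>x\<in>X. g x = f x)"
  proof (cases "X = {}")
    case True
    then show ?thesis by (intro exI[of _ id]) (auto simp: automorphism_def)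
  next
    case False
    define R where "R = (\<lambda>x. (x, f x)) ` X"
    have "Domain R = X" by (auto simp: R_def)
    then have "partial_iso A A R"
      using con f arcs by (auto simp: partial_iso_def R_def bij_betw_def inj_on_eq_iff)
    moreover have "R \<subseteq> V \<times> V" "R \<noteq> {}" using X Y f False by (auto simp: R_def bij_betw_def)
    ultimately obtain g where "bij_betw g V V" "\<forall>x\<in>V. \<forall>y\<in>V. A x y \<longleftrightarrow> A (g x) (g y)" "\<forall>(x, x')\<in>R. g x = x'"
      using partial_iso_extends_to_iso[OF V V] by blast
    then show ?thesis by (intro exI[of _ g]) (auto simp: automorphism_def R_def)
  qed
qed

lemma connected_homogeneous_iso:
  assumes iso: "digraph_iso V A W B" and W: "connected_homogeneous W B"
  shows "connected_homogeneous V A"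
  unfolding connected_homogeneous_def
proof (intro allI impI, elim conjE)
  fix X Y f
  assume X: "X \<subseteq> V" "finite X" "uconnected_on X A" and Y: "Y \<subseteq> V" "finite Y" "uconnected_on Y A"
    and f: "bij_betw f X Y" and arcs: "\<forall>x\<in>X. \<forall>y\<in>X. A x y \<longleftrightarrow> A (f x) (f y)"
  obtain h where h: "bij_betw h V W" and hA: "\<And>x y. x \<in> V \<Longrightarrow> y \<in> V \<Longrightarrow> A x y \<longleftrightarrow> B (h x) (h y)"
    using iso unfolding digraph_iso_def by blast
  let ?k = "inv_into V h"
  have k: "?k (h x) = x" if "x \<in> V" for x using h that by (simp add: bij_betw_inv_into_left)
  have img: "uconnected_on (h ` Z) B" if "Z \<subseteq> V" "uconnected_on Z A" for Z
    by (rule uconnected_on_image[OF that(2)]) (use hA that(1) in \<open>auto simp: uadj_def\<close>)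
  have fY: "f x \<in> V" if "x \<in> X" for x using f Y that by (auto simp: bij_betw_def)
  have "\<exists>g. automorphism W B g \<and> (\<forall>x\<in>h ` X. g x = (h \<circ> f \<circ> ?k) x)"
  proof (rule W[unfolded connected_homogeneous_def, rule_format, of "h ` X" "h ` Y"], intro conjI)
    show "h ` X \<subseteq> W" "h ` Y \<subseteq> W" using h X Y by (auto simp: bij_betw_def)
    show "uconnected_on (h ` X) B" "uconnected_on (h ` Y) B" using img X Y by auto
    have hX: "bij_betw h X (h ` X)" "bij_betw h Y (h ` Y)"
      using h X Y by (auto simp: bij_betw_def intro: inj_on_subset)
    have "bij_betw ?k (h ` X) X"
      by (rule bij_betw_byWitness[of _ h]) (use k X in auto)
    then show "bij_betw (h \<circ> f \<circ> ?k) (h ` X) (h ` Y)"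
      using f hX(2) by (blast intro: bij_betw_trans)
    show "\<forall>x\<in>h ` X. \<forall>y\<in>h ` X. B x y \<longleftrightarrow> B ((h \<circ> f \<circ> ?k) x) ((h \<circ> f \<circ> ?k) y)"
    proof (intro ballI)
      fix x y assume "x \<in> h ` X" "y \<in> h ` X"
      then obtain a b where ab: "a \<in> X" "b \<in> X" "x = h a" "y = h b" by blast
      then have "a \<in> V" "b \<in> V" using X by auto
      then show "B x y \<longleftrightarrow> B ((h \<circ> f \<circ> ?k) x) ((h \<circ> f \<circ> ?k) y)"
        using ab k arcs hA[of a b] hA[of "f a" "f b"] fY by simp
    qed
  qed (use X Y in auto)
  then obtain g where g: "bij_betw g W W" "\<And>x y. x \<in> W \<Longrightarrow> y \<in> W \<Longrightarrow> B x y \<longleftrightarrow> B (g x) (g y)"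
    "\<And>x. x \<in> X \<Longrightarrow> g (h x) = h (f (?k (h x)))"
    unfolding automorphism_def by auto
  have kb: "bij_betw ?k W V" using h by (rule bij_betw_inv_into)
  have hk: "h (?k y) = y" if "y \<in> W" for y using h that by (simp add: bij_betw_inv_into_right)
  have hW: "h x \<in> W" "g (h x) \<in> W" "?k (g (h x)) \<in> V" if "x \<in> V" for x
    using that h g(1) kb bij_betwE by metis+
  have "automorphism V A (?k \<circ> g \<circ> h)"
    unfolding automorphism_def
  proof
    show "bij_betw (?k \<circ> g \<circ> h) V V" using h g(1) kb by (blast intro: bij_betw_trans)
    show "\<forall>x\<in>V. \<forall>y\<in>V. A x y \<longleftrightarrow> A ((?k \<circ> g \<circ> h) x) ((?k \<circ> g \<circ> h) y)"
    proof (intro ballI)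
      fix x y assume "x \<in> V" "y \<in> V"
      then show "A x y \<longleftrightarrow> A ((?k \<circ> g \<circ> h) x) ((?k \<circ> g \<circ> h) y)"
        using hA[of x y] g(2)[of "h x" "h y"] hA[of "?k (g (h x))" "?k (g (h y))"] hk hW by simp
    qed
  qed
  moreover have "\<forall>x\<in>X. (?k \<circ> g \<circ> h) x = f x"
  proof
    fix x assume x: "x \<in> X"
    then have "x \<in> V" using X by blast
    then show "(?k \<circ> g \<circ> h) x = f x" using g(3)[OF x] k[of x] k[OF fY[OF x]] by simp
  qed
  ultimately show "\<exists>g. automorphism V A g \<and> (\<forall>x\<in>X. g x = f x)" by blast
qed

section \<open>The digraphs \<open>T(r)\<close>\<close>

lemma T_V_snoc:
  "u @ [(i, e)] \<in> T_V r \<longleftrightarrow> u \<in> T_V r \<and> i < r \<and> e \<in> {1, 2} \<and> (u \<noteq> [] \<longrightarrow> fst (last u) \<noteq> i)"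
proof -
  have "(\<forall>k. Suc k < length (u @ [(i, e)]) \<longrightarrow> fst ((u @ [(i, e)]) ! k) \<noteq> fst ((u @ [(i, e)]) ! Suc k)) \<longleftrightarrow>
    (\<forall>k. Suc k < length u \<longrightarrow> fst (u ! k) \<noteq> fst (u ! Suc k)) \<and> (u \<noteq> [] \<longrightarrow> fst (last u) \<noteq> i)"
    (is "?L \<longleftrightarrow> ?R")
  proof
    assume L: ?L
    have "fst (u ! k) \<noteq> fst (u ! Suc k)" if "Suc k < length u" for k
      using L[rule_format, of k] that by (simp add: nth_append)
    moreover have "fst (last u) \<noteq> i" if "u \<noteq> []"
      using L[rule_format, of "length u - 1"] that by (simp add: nth_append last_conv_nth)
    ultimately show ?R by blast
  next
    assume R: ?R
    show ?L
    proof (intro allI impI)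
      fix k assume k: "Suc k < length (u @ [(i, e)])"
      show "fst ((u @ [(i, e)]) ! k) \<noteq> fst ((u @ [(i, e)]) ! Suc k)"
      proof (cases "Suc k < length u")
        case True
        then show ?thesis using R by (simp add: nth_append)
      next
        case False
        then have "length u = Suc k" using k by simp
        then show ?thesis using R by (auto simp: nth_append last_conv_nth)
      qed
    qed
  qed
  then show ?thesis by (auto simp: T_V_def)
qed

lemma T_V_Nil: "[] \<in> T_V r"
  by (simp add: T_V_def)

text \<open>The coset of \<open>w\<close> modulo the subgroup generated by \<open>a_i\<close>
  consists of \<open>u\<close>, \<open>u a_i\<close> and \<open>u a_i^2\<close> for a reduced word
  \<open>u\<close> not ending in a power of \<open>a_i\<close>; the cases say which of the three
  \<open>w\<close> is.\<close>

lemma mult_gen_cases: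
  assumes w: "w \<in> T_V r" and i: "i < r"
  obtains (append) "w = [] \<or> fst (last w) \<noteq> i" "mult_gen w i = w @ [(i, 1)]"
      "mult_gen (mult_gen w i) i = w @ [(i, 2)]"
  | (swap) u where "w = u @ [(i, 1)]" "mult_gen w i = u @ [(i, 2)]" "mult_gen (mult_gen w i) i = u"
      "u \<in> T_V r" "u = [] \<or> fst (last u) \<noteq> i"
  | (cancel) u where "w = u @ [(i, 2)]" "mult_gen w i = u" "mult_gen (mult_gen w i) i = u @ [(i, 1)]"
      "u \<in> T_V r" "u = [] \<or> fst (last u) \<noteq> i"
proof (cases "w \<noteq> [] \<and> fst (last w) = i")
  case False
  then show ?thesis using append by (auto simp: mult_gen_def)
next
  case True
  then obtain u e where ue: "w = u @ [(i, e)]" by (metis append_butlast_last_id prod.collapse)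
  then have u: "u \<in> T_V r" "e \<in> {1, 2}" "u = [] \<or> fst (last u) \<noteq> i" using w by (auto simp: T_V_snoc)
  show ?thesis
  proof (cases "e = 1")
    case True
    then show ?thesis using swap ue u by (auto simp: mult_gen_def)
  next
    case False
    then show ?thesis using cancel ue u by (auto simp: mult_gen_def)
  qed
qed

lemma mult_gen_in: "w \<in> T_V r \<Longrightarrow> i < r \<Longrightarrow> mult_gen w i \<in> T_V r"
  by (rule mult_gen_cases[of w r i]) (auto simp: T_V_snoc)

lemma mult_gen_cube:
  assumes "w \<in> T_V r" "i < r"
  shows "mult_gen (mult_gen (mult_gen w i) i) i = w"
  using assms by (cases rule: mult_gen_cases) (auto simp: mult_gen_def)

lemma mult_gen_neq:
  assumes "w \<in> T_V r" "i < r"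
  shows "mult_gen w i \<noteq> w" "mult_gen (mult_gen w i) i \<noteq> w"
proof -
  show "mult_gen w i \<noteq> w" using assms by (cases rule: mult_gen_cases) auto
  show "mult_gen (mult_gen w i) i \<noteq> w" using assms by (cases rule: mult_gen_cases) auto
qed

lemma T_uadj_iff:
  assumes w: "w \<in> T_V r"
  shows "uadj (T_arc r) w v \<longleftrightarrow> (\<exists>i<r. v = mult_gen w i \<or> v = mult_gen (mult_gen w i) i)"
proof
  assume "uadj (T_arc r) w v"
  then consider "T_arc r w v" | "T_arc r v w" by (auto simp: uadj_def)
  then show "\<exists>i<r. v = mult_gen w i \<or> v = mult_gen (mult_gen w i) i"
  proof cases
    case 1
    then show ?thesis by (auto simp: T_arc_def)
  next
    case 2
    then obtain i where "v \<in> T_V r" "i < r" "w = mult_gen v i" by (auto simp: T_arc_def)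
    then show ?thesis using mult_gen_cube by (intro exI[of _ i]) auto
  qed
next
  assume "\<exists>i<r. v = mult_gen w i \<or> v = mult_gen (mult_gen w i) i"
  then obtain i where i: "i < r" "v = mult_gen w i \<or> v = mult_gen (mult_gen w i) i" by blast
  then show "uadj (T_arc r) w v"
    using w mult_gen_in[OF w i(1)] mult_gen_in[OF mult_gen_in[OF w i(1)] i(1)] mult_gen_cube[OF w i(1)]
    unfolding uadj_def T_arc_def by metis
qed

text \<open>For \<open>w \<noteq> x\<close>, the component of \<open>w\<close> after removing \<open>x\<close>: the index of the letter following \<open>x\<close>
  if \<open>w\<close> properly extends \<open>x\<close>.\<close>

definition branch :: "(nat \<times> nat) list \<Rightarrow> (nat \<times> nat) list \<Rightarrow> nat option" where
  "branch x w = (if length x < length w \<and> take (length x) w = x then Some (fst (w ! length x)) else None)"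

text \<open>A generator affects only the last letter and keeps its index if the letter survives, so
  the letter following \<open>x\<close> can appear or vanish only if one of the two words is
  \<open>x\<close> itself.\<close>

lemma branch_mult_gen:
  assumes w: "w \<in> T_V r" and i: "i < r" and ne: "w \<noteq> x" "mult_gen w i \<noteq> x"
  shows "branch x (mult_gen w i) = branch x w"
  using w i
proof (cases rule: mult_gen_cases)
  case append
  moreover have "length x < length w" if "length x < Suc (length w)" "take (length x) w = x"
    using that ne by (cases "length x = length w") auto
  ultimately show ?thesis using ne by (auto simp: branch_def nth_append)
next
  case (swap u)
  then show ?thesis using ne by (auto simp: branch_def nth_append)
next
  case (cancel u)
  then show ?thesis using ne by (auto simp: branch_def nth_append)
qed

lemma branch_uadj:
  assumes "uadj (T_arc r) v w" "v \<noteq> x" "w \<noteq> x"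
  shows "branch x v = branch x w"
  using assms branch_mult_gen[of _ r _ x] by (auto simp: uadj_def T_arc_def)

text \<open>Different generators lead into different branches. \<open>None\<close> is the branch of
  words not extending \<open>x\<close>, entered by the generator that merges with the last letter of
  \<open>x\<close>.\<close>

lemma branch_nbr:
  assumes x: "x \<in> T_V r" and i: "i < r" and v: "v = mult_gen x i \<or> v = mult_gen (mult_gen x i) i"
  shows "branch x v = (if x \<noteq> [] \<and> fst (last x) = i then None else Some i)"
  using x i by (cases rule: mult_gen_cases) (use v in \<open>auto simp: branch_def\<close>)

lemma branch_nbrs_eq:
  assumes x: "x \<in> T_V r" and y: "uadj (T_arc r) x y" and z: "uadj (T_arc r) x z" and b: "branch x y = branch x z"
  obtains i where "i < r" "y = mult_gen x i \<or> y = mult_gen (mult_gen x i) i"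
    "z = mult_gen x i \<or> z = mult_gen (mult_gen x i) i"
proof -
  obtain i where i: "i < r" "y = mult_gen x i \<or> y = mult_gen (mult_gen x i) i"
    using T_uadj_iff[OF x] y by blast
  obtain j where j: "j < r" "z = mult_gen x j \<or> z = mult_gen (mult_gen x j) j"
    using T_uadj_iff[OF x] z by blast
  have "i = j" using b branch_nbr[OF x i] branch_nbr[OF x j] by (auto split: if_splits)
  then show ?thesis using that i j by blast
qed

lemma T_uadj_V: "uadj (T_arc r) x y \<Longrightarrow> x \<in> T_V r \<and> y \<in> T_V r"
  by (auto simp: uadj_def T_arc_def mult_gen_in)

lemma T_uadj_neq: "uadj (T_arc r) x y \<Longrightarrow> x \<noteq> y"
  using mult_gen_neq(1) unfolding uadj_def T_arc_def by metis

lemma mult_gen_inj: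
  assumes x: "x \<in> T_V r" and i: "i < r" "j < r" and eq: "mult_gen x i = mult_gen x j"
  shows "i = j"
  using branch_nbr[OF x i(1) disjI1[OF refl]] branch_nbr[OF x i(2) disjI1[OF eq]]
  by (auto split: if_splits)

lemma T_reaches_Nil: "w \<in> T_V r \<Longrightarrow> (\<lambda>u v. u \<in> T_V r \<and> v \<in> T_V r \<and> uadj (T_arc r) u v)\<^sup>*\<^sup>* w []"
proof (induction w rule: rev_induct)
  case (snoc p u)
  obtain i e where p: "p = (i, e)" by (cases p)
  then have u: "u \<in> T_V r" "i < r" "e \<in> {1, 2}" "u \<noteq> [] \<longrightarrow> fst (last u) \<noteq> i"
    using snoc.prems by (auto simp: T_V_snoc)
  have "uadj (T_arc r) (u @ [p]) u"
  proof (cases "e = 1")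
    case True
    then have "u @ [p] = mult_gen u i" using u p by (auto simp: mult_gen_def)
    then show ?thesis using u unfolding uadj_def T_arc_def by metis
  next
    case False
    then have "mult_gen (u @ [p]) i = u" using u p by (auto simp: mult_gen_def)
    then show ?thesis using u snoc.prems unfolding uadj_def T_arc_def by metis
  qed
  then show ?case using snoc u
    by (intro converse_rtranclp_into_rtranclp[of _ "u @ [p]" u]) auto
qed simp

lemma T_triangle_tree: "triangle_tree (T_V r) (T_arc r) r"
proof
  show "digraph (T_V r) (T_arc r)"
    unfolding digraph_def
  proof (intro conjI allI impI)
    fix x y assume xy: "T_arc r x y"
    then show "x \<in> T_V r" "y \<in> T_V r" using T_uadj_V[of r x y] by (auto simp: uadj_def)
    show "\<not> T_arc r y x"
    proof
      assume yx: "T_arc r y x"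
      obtain i where i: "x \<in> T_V r" "i < r" "y = mult_gen x i" using xy by (auto simp: T_arc_def)
      obtain j where j: "y \<in> T_V r" "j < r" "x = mult_gen y j" using yx by (auto simp: T_arc_def)
      \<comment> \<open>With opposite arcs, \<open>x\<close> is a neighbour of \<open>y\<close>
        through \<open>a_i\<close> and through \<open>a_j\<close>; the branches force
        \<open>i = j\<close>, and then \<open>a_i\<close> would have order two.\<close>
      have "x = mult_gen (mult_gen y i) i" using mult_gen_cube i by metis
      from branch_nbr[OF j(1) i(2) disjI2[OF this]] branch_nbr[OF j(1,2) disjI1[OF j(3)]]
      have "i = j" by (auto split: if_splits)
      then show False using mult_gen_neq(2)[OF i(1,2)] i(3) j(3) by metis
    qed
  next
    show "\<not> T_arc r x x" for x using T_uadj_neq[of r x x] by (auto simp: uadj_def)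
  qed
  have "(\<lambda>u v. u \<in> T_V r \<and> v \<in> T_V r \<and> uadj (T_arc r) u v)\<^sup>*\<^sup>* [] w" if "w \<in> T_V r" for w
  proof -
    have "symp (\<lambda>u v. u \<in> T_V r \<and> v \<in> T_V r \<and> uadj (T_arc r) u v)" by (auto simp: symp_def uadj_def)
    from sympD[OF symp_rtranclp[OF this] T_reaches_Nil[OF that]] show ?thesis .
  qed
  then show "connected_digraph (T_V r) (T_arc r)"
    unfolding connected_digraph_def uconnected_on_def
    using T_V_Nil[of r] rtranclp_trans[OF T_reaches_Nil] by blast
next
  fix x assume x: "x \<in> T_V r"
  have "{y. T_arc r x y} = mult_gen x ` {..<r}" using x by (auto simp: T_arc_def)
  moreover have "inj_on (mult_gen x) {..<r}" using mult_gen_inj[OF x] by (auto simp: inj_on_def)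
  ultimately show "finite {y. T_arc r x y} \<and> card {y. T_arc r x y} = r" by (simp add: card_image)
next
  fix x y assume "T_arc r x y"
  then obtain i where i: "x \<in> T_V r" "i < r" "y = mult_gen x i" by (auto simp: T_arc_def)
  have "T_arc r y (mult_gen y i)" "T_arc r (mult_gen y i) x"
    unfolding T_arc_def i(3) using mult_gen_cube[OF i(1,2)] i(2)
      mult_gen_in[OF i(1,2)] mult_gen_in[OF mult_gen_in[OF i(1,2)] i(2)] by metis+
  then show "\<exists>z. T_arc r y z \<and> T_arc r z x" by blast
next
  fix x y z w assume xy: "uadj (T_arc r) x y" and xz: "uadj (T_arc r) x z" and yz: "uadj (T_arc r) y z"
    and xw: "uadj (T_arc r) x w" and yw: "uadj (T_arc r) y w"
  have x: "x \<in> T_V r" using T_uadj_V xy by blast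
  \<comment> \<open>The edges from \<open>y\<close> to \<open>z\<close> and \<open>w\<close> avoid
    \<open>x\<close>, so all three lie in one branch at \<open>x\<close>, which contains only two
    neighbours of \<open>x\<close>.\<close>
  have b: "branch x y = branch x z" "branch x y = branch x w"
    using branch_uadj[OF yz] branch_uadj[OF yw] T_uadj_neq xy xz xw by metis+
  obtain i where i: "i < r" "y = mult_gen x i \<or> y = mult_gen (mult_gen x i) i"
    "z = mult_gen x i \<or> z = mult_gen (mult_gen x i) i" using branch_nbrs_eq[OF x xy xz b(1)] .
  obtain j where j: "j < r" "y = mult_gen x j \<or> y = mult_gen (mult_gen x j) j"
    "w = mult_gen x j \<or> w = mult_gen (mult_gen x j) j" using branch_nbrs_eq[OF x xy xw b(2)] .
  have "i = j" using branch_nbr[OF x i(1,2)] branch_nbr[OF x j(1,2)] by (auto split: if_splits)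
  then show "z = w" using i j T_uadj_neq[OF yz] T_uadj_neq[OF yw] by auto
next
  fix x y z assume xy: "uadj (T_arc r) x y" and xz: "uadj (T_arc r) x z"
    and p: "(\<lambda>u v. u \<noteq> x \<and> v \<noteq> x \<and> uadj (T_arc r) u v)\<^sup>*\<^sup>* y z"
  have x: "x \<in> T_V r" using T_uadj_V xy by blast
  have "branch x y = branch x z" using p by (induction rule: rtranclp_induct) (auto dest: branch_uadj)
  then obtain i where i: "i < r" "y = mult_gen x i \<or> y = mult_gen (mult_gen x i) i"
    "z = mult_gen x i \<or> z = mult_gen (mult_gen x i) i" using branch_nbrs_eq[OF x xy xz] by blast
  have "uadj (T_arc r) (mult_gen x i) (mult_gen (mult_gen x i) i)"
    using i mult_gen_in[OF x i(1)] by (auto simp: uadj_def T_arc_def)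
  then show "y = z \<or> uadj (T_arc r) y z" using i by (auto simp: uadj_def)
qed

section \<open>Homogeneous digraphs are triangle trees\<close>

context reduced_orientation
begin

lemma triangle_tree_of_reduced_orientation:
  assumes x0: "x\<^sub>0 \<in> V"
  shows "triangle_tree V A (card {y. A x\<^sub>0 y})"
proof
  show "digraph V A" "connected_digraph V A" by (rule dg, rule con)
next
  fix x assume x: "x \<in> V"
  obtain g where g: "automorphism V A g" "g x\<^sub>0 = x" using vertex_transitive[OF x0 x] .
  have inj: "inj_on g V" and im: "g ` V = V" using aut_bij[OF g(1)] by (auto simp: bij_betw_def)
  have "{y. A x y} = g ` {y. A x\<^sub>0 y}"
  proof
    show "g ` {y. A x\<^sub>0 y} \<subseteq> {y. A x y}" using aut_arc[OF g(1) x0] arc_V g by auto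
    show "{y. A x y} \<subseteq> g ` {y. A x\<^sub>0 y}"
    proof
      fix y assume y: "y \<in> {y. A x y}"
      then obtain y' where "y' \<in> V" "y = g y'" using arc_V im by blast
      then show "y \<in> g ` {y. A x\<^sub>0 y}" using y aut_arc[OF g(1) x0, of y'] g by auto
    qed
  qed
  moreover have "inj_on g {y. A x\<^sub>0 y}" using arc_V by (intro inj_on_subset[OF inj]) auto
  ultimately have "card {y. A x y} = card {y. A x\<^sub>0 y}" by (simp add: card_image)
  then show "finite {y. A x y} \<and> card {y. A x y} = card {y. A x\<^sub>0 y}"
    using lf x by (simp add: locally_finite_def)
next
  show "\<exists>z. A y z \<and> A z x" if "A x y" for x y using unique_directed_triangle[OF that] by blast
next
  fix x y z w assume "adj x y" and zw: "adj x z" "adj y z" "adj x w" "adj y w"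
  then consider "A x y" | "A y x" by (auto simp: uadj_def)
  then obtain t where "{w. adj x w \<and> adj y w} = {t}"
  proof cases
    case 1
    then show ?thesis using unique_directed_triangle that by blast
  next
    case 2
    then obtain t where "{w. adj y w \<and> adj x w} = {t}" using unique_directed_triangle by blast
    then show ?thesis using that by (simp add: conj_commute)
  qed
  then show "z = w" using zw by (metis (mono_tags, lifting) mem_Collect_eq singletonD)
next
  show "y = z \<or> adj y z"
    if "adj x y" "adj x z" "(\<lambda>u v. u \<noteq> x \<and> v \<noteq> x \<and> adj u v)\<^sup>*\<^sup>* y z" for x y z
    using nbrs_separated[OF that] .
qed

end

lemma triangle_tree_of_homogeneous:
  assumes dg: "digraph V A" and con: "connected_digraph V A" and lf: "locally_finite V A"
    and ends: "more_than_one_end V A" and tri: "embeds_triangle V A" and hom: "connected_homogeneous V A"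
  shows "\<exists>r. triangle_tree V A r"
proof -
  interpret cut_graph V "uadj A"
  proof
    show "uadj A v u" if "uadj A u v" for u v using that by (simp add: uadj_sym)
    show "u \<in> V \<and> v \<in> V" if "uadj A u v" for u v using that dg by (auto simp: uadj_def digraph_def)
    show "(uadj A)\<^sup>*\<^sup>* u v" if "u \<in> V" "v \<in> V" for u v
    proof -
      have "(\<lambda>u v. u \<in> V \<and> v \<in> V \<and> uadj A u v)\<^sup>*\<^sup>* u v"
        using con that by (auto simp: connected_digraph_def uconnected_on_def)
      then show ?thesis by (rule mono_rtranclp[rule_format, rotated]) simp
    qed
    show "\<exists>C\<subseteq>V. infinite C \<and> infinite (V - C) \<and> finite (edge_bd (uadj A) C)"
      using finite_cut_of_ends[OF dg lf ends] by (simp add: edge_bd_def)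
  qed
  interpret homogeneous_cut_system V A opt_cuts
  proof
    show "e \<subseteq> V \<and> infinite e \<and> infinite (V - e) \<and> finite (edge_bd (uadj A) e)" if "e \<in> opt_cuts" for e
      using that by (auto simp: opt_cuts_def narrow_def is_cut_def)
    show "e \<subseteq> f \<or> f \<subseteq> e \<or> e \<inter> f = {} \<or> V \<subseteq> e \<union> f" if "e \<in> opt_cuts" "f \<in> opt_cuts" for e f
      using opt_cuts_nested[OF that] by (simp add: nested_def)
    show "g ` e \<in> opt_cuts" if "automorphism V A g" "e \<in> opt_cuts" for g e
    proof (rule aut_opt_cuts[OF _ that(2)])
      show "aut g" using that(1) by (auto simp: aut_def automorphism_def uadj_def)
    qed
  qed (use dg con lf hom tri ex_opt_cut opt_cuts_compl finite_opt_cuts_separating in auto)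
  obtain \<sigma> n where "reduced_orientation V A opt_cuts \<sigma> n" using ex_reduced_orientation by blast
  then interpret reduced_orientation V A opt_cuts \<sigma> n .
  obtain x where "x \<in> V" using con by (auto simp: connected_digraph_def)
  then show ?thesis using triangle_tree_of_reduced_orientation by blast
qed

theorem theorem7p1:
  fixes V :: "'a set" and A :: "'a \<Rightarrow> 'a \<Rightarrow> bool"
  assumes "digraph V A"
    and "connected_digraph V A"
    and "locally_finite V A"
    and "more_than_one_end V A"
    and "embeds_triangle V A"
  shows "connected_homogeneous V A \<longleftrightarrow> (\<exists>r::nat. digraph_iso V A (T_V r) (T_arc r))"
proof
  assume "connected_homogeneous V A"
  then obtain r where "triangle_tree V A r" using triangle_tree_of_homogeneous[OF assms] by blast
  then show "\<exists>r. digraph_iso V A (T_V r) (T_arc r)" using triangle_tree_iso T_triangle_tree by blast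
next
  assume "\<exists>r. digraph_iso V A (T_V r) (T_arc r)"
  then show "connected_homogeneous V A"
    using connected_homogeneous_iso triangle_tree_homogeneous[OF T_triangle_tree] by blast
qed

end
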